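(* Let $X$ be a measure space, $r\colon X\to X$ a measurable, finite-to-one, onto map, and $\mu$ a strongly $r$-invariant probability measure on $X$. Let $H$ be a Hilbert space, $S$ an isometry on $H$, and $\pi$ a normal representation of $L^\infty(X)$ on $H$ such that $$S\pi(g)=\pi(g\circ r)S,\qquad g\in L^\infty(X).$$ Let $\hat H\supset H$ be a Hilbert space, $\hat S$ a unitary operator on $\hat H$ and $\hat\pi$ a representation of $L^\infty(X)$ on $\hat H$ such that the subspaces $V_n:=\hat S^{-n}(H)$, $n\ge 0$, form an increasing sequence with dense union in $\hat H$, $\hat S|_H=S$, $\hat\pi(g)|_H=\pi(g)$ and $\hat S\hat\pi(g)=\hat\pi(g\circ r)\hat S$ for all $g\in L^\infty(X)$ (such a dilation exists and is unique up to an intertwining isomorphism). (i) The space $V_1=\hat S^{-1}(H)$ is invariant for the representation $\hat\pi$. The multiplicity functions $m_{V_1}$ and $m_{V_0}$ of the representation $\hat\pi$ on $V_1$ and on $V_0=H$ are related by $$m_{V_1}(x)=\sum_{r(y)=x}m_{V_0}(y),\qquad x\in X.$$ (ii) If $W_0:=V_1\ominus V_0=\hat S^{-1}H\ominus H$, and $m_{W_0}$ is the multiplicity function of $\hat\pi$ on $W_0$, then $$m_{V_0}(x)+m_{W_0}(x)=\sum_{r(y)=x}m_{V_0}(y),\qquad x\in X.$$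
   Context: The measure $\mu$ is strongly $r$-invariant if $$\int_X f\,d\mu=\int_X\frac{1}{\#\,r^{-1}(x)}\sum_{r(y)=x}f(y)\,d\mu(x)\qquad\text{for all } f\in L^\infty(X,\mu)$$ (the fibre averages on the right being understood to be measurable in $x$). $L^\infty(X)=L^\infty(X,\mu)$. A representation of $L^\infty(X)$ is normal if it is a $*$-representation continuous on bounded sets for the weak-$*$ topology of $L^\infty(X)$ and the weak operator topology (equivalently, all functionals $g\mapsto\langle k\mid\pi(g)k\rangle$ are given by integration against $L^1(\mu)$-densities). Multiplicity function: for a measurable $m\colon X\to\{0,1,\dots,\infty\}$ let $L^2(X,m,\mu)$ be the Hilbert space of measurable $f\colon X\to\bigcup_{x}\mathbb{C}^{m(x)}$ with $f(x)\in\mathbb{C}^{m(x)}$ and $\int_X\|f(x)\|^2\,d\mu(x)<\infty$ (with $\mathbb{C}^\infty:=\ell^2(\mathbb{N})$). Hilbert spaces are separable. By the spectral theorem, for a normal representation $\pi$ of $L^\infty(X)$ on a Hilbert space $K$ there is a $\mu$-a.e. unique $m=m_K$, the multiplicity function, such that some unitary $J\colon K\to L^2(X,m,\mu)$ satisfies $(J\pi(g)J^{-1}f)(x)=g(x)f(x)$. Equalities between multiplicity functions are understood $\mu$-a.e.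
   Formalization: The measure space X is additionally assumed countably separated (countably many measurable sets separate its points); for an arbitrary measure space the formula fails, e.g. X = ℕ with the trivial σ-algebra, r(n) = ⌊n/2⌋, H = Ĥ = ℂ. *)

theory Defs
  imports "HOL-Probability.Probability"
begin

section \<open>Complex Hilbert spaces\<close>

text \<open>The inner product is linear in the second argument. The underlying real inner product is its
  real part, so norm, topology and completeness are those of \<^class>\<open>real_inner\<close> and
  \<^class>\<open>complete_space\<close>.\<close>

class complex_hilbert = real_inner + complete_space +
  fixes scaleC :: "complex \<Rightarrow> 'a \<Rightarrow> 'a"  (infixr \<open>*\<^sub>C\<close> 75)
    and cinner :: "'a \<Rightarrow> 'a \<Rightarrow> complex"
  assumes scaleC_add_right: "c *\<^sub>C (x + y) = c *\<^sub>C x + c *\<^sub>C y"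
    and scaleC_add_left: "(c + d) *\<^sub>C x = c *\<^sub>C x + d *\<^sub>C x"
    and scaleC_scaleC: "c *\<^sub>C d *\<^sub>C x = (c * d) *\<^sub>C x"
    and scaleR_scaleC: "r *\<^sub>R x = complex_of_real r *\<^sub>C x"
    and cinner_commute: "cinner x y = cnj (cinner y x)"
    and cinner_add_right: "cinner x (y + z) = cinner x y + cinner x z"
    and cinner_scaleC_right: "cinner x (c *\<^sub>C y) = c * cinner x y"
    and inner_eq_Re_cinner: "x \<bullet> y = Re (cinner x y)"

global_interpretation complex_vector:
  vector_space "scaleC :: complex \<Rightarrow> 'a \<Rightarrow> 'a::complex_hilbert"
proof
  show "1 *\<^sub>C x = x" for x :: 'a
    using scaleR_scaleC[of 1 x] by simp
qed (simp_all add: scaleC_add_right scaleC_add_left scaleC_scaleC)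

abbreviation csubspace :: "'a::complex_hilbert set \<Rightarrow> bool"
  where "csubspace \<equiv> complex_vector.subspace"

instantiation complex :: complex_hilbert
begin
definition scaleC_complex :: "complex \<Rightarrow> complex \<Rightarrow> complex" where "scaleC_complex = (*)"
definition cinner_complex :: "complex \<Rightarrow> complex \<Rightarrow> complex" where "cinner_complex x y = cnj x * y"
instance
  by standard
    (simp_all add: scaleC_complex_def cinner_complex_def inner_complex_def algebra_simps
      scaleR_conv_of_real)
end

text \<open>Operators on a closed subspace \<open>K\<close> of the ambient Hilbert space are functions on the
  ambient type of which only the values on \<open>K\<close> matter.\<close>

definition clinear_on :: "'h::complex_hilbert set \<Rightarrow> ('h \<Rightarrow> 'h) \<Rightarrow> bool"
  where "clinear_on K T \<longleftrightarrow>
    (\<forall>k\<in>K. \<forall>l\<in>K. T (k + l) = T k + T l) \<and> (\<forall>c. \<forall>k\<in>K. T (c *\<^sub>C k) = c *\<^sub>C T k)"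

definition bounded_operators :: "'h::complex_hilbert set \<Rightarrow> ('h \<Rightarrow> 'h) set"
  where "bounded_operators K =
    {T. T ` K \<subseteq> K \<and> clinear_on K T \<and> (\<exists>B. \<forall>k\<in>K. norm (T k) \<le> B * norm k)}"

definition isometry_on :: "'h::complex_hilbert set \<Rightarrow> ('h \<Rightarrow> 'h) \<Rightarrow> bool"
  where "isometry_on K S \<longleftrightarrow> S ` K \<subseteq> K \<and> clinear_on K S \<and> (\<forall>k\<in>K. norm (S k) = norm k)"

definition unitary :: "('h::complex_hilbert \<Rightarrow> 'h) \<Rightarrow> bool"
  where "unitary U \<longleftrightarrow> clinear_on UNIV U \<and> bij U \<and> (\<forall>x y. cinner (U x) (U y) = cinner x y)"

definition ominus :: "'h::complex_hilbert set \<Rightarrow> 'h set \<Rightarrow> 'h set"  (infixl \<open>\<ominus>\<close> 65)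
  where "V \<ominus> U = {v \<in> V. \<forall>u\<in>U. cinner u v = 0}"

section \<open>The measure space and the endomorphism\<close>

text \<open>Points are separated by countably many measurable sets; this holds in every standard Borel
  space and in every Lebesgue space.\<close>

definition countably_separated :: "'x measure \<Rightarrow> bool"
  where "countably_separated M \<longleftrightarrow>
    (\<exists>\<A>. countable \<A> \<and> \<A> \<subseteq> sets M \<and>
      (\<forall>x\<in>space M. \<forall>y\<in>space M. x \<noteq> y \<longrightarrow> (\<exists>A\<in>\<A>. (x \<in> A) \<noteq> (y \<in> A))))"

definition fibre :: "'x measure \<Rightarrow> ('x \<Rightarrow> 'x) \<Rightarrow> 'x \<Rightarrow> 'x set"
  where "fibre M r x = {y \<in> space M. r y = x}"

text \<open>Elements of \<open>L\<^sup>\<infinity>\<close> are represented by functions, to be identified when equal almost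
  everywhere.\<close>

definition Linf :: "'x measure \<Rightarrow> ('x \<Rightarrow> complex) set"
  where "Linf M = {g \<in> borel_measurable M. \<exists>C. AE x in M. cmod (g x) \<le> C}"

definition Linf_ball :: "'x measure \<Rightarrow> real \<Rightarrow> ('x \<Rightarrow> complex) set"
  where "Linf_ball M C = {g \<in> borel_measurable M. AE x in M. cmod (g x) \<le> C}"

definition strongly_invariant :: "'x measure \<Rightarrow> ('x \<Rightarrow> 'x) \<Rightarrow> bool"
  where "strongly_invariant M r \<longleftrightarrow>
    (\<forall>f\<in>Linf M.
      (\<lambda>x. (\<Sum>y\<in>fibre M r x. f y) / of_nat (card (fibre M r x))) \<in> borel_measurable M \<and>
      (LINT x|M. f x) = (LINT x|M. (\<Sum>y\<in>fibre M r x. f y) / of_nat (card (fibre M r x))))"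

section \<open>Normal representations\<close>

definition weak_star_topology :: "'x measure \<Rightarrow> ('x \<Rightarrow> complex) topology"
  where "weak_star_topology M = topology_generated_by
    {{g \<in> Linf M. (LINT x|M. g x * h x) \<in> U} | h U. integrable M h \<and> open U}"

definition weak_operator_topology :: "'h::complex_hilbert set \<Rightarrow> ('h \<Rightarrow> 'h) topology"
  where "weak_operator_topology K = topology_generated_by
    {{T \<in> bounded_operators K. cinner k (T l) \<in> U} | k l U. k \<in> K \<and> l \<in> K \<and> open U}"

text \<open>Representations are unital: otherwise they are not multiplication representations on any
  \<open>L\<^sup>2(X, m, \<mu>)\<close>.\<close>

definition Linf_representation ::
    "'x measure \<Rightarrow> (('x \<Rightarrow> complex) \<Rightarrow> 'h \<Rightarrow> 'h) \<Rightarrow> 'h::complex_hilbert set \<Rightarrow> bool"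
  where "Linf_representation M \<pi> K \<longleftrightarrow>
    (\<forall>g\<in>Linf M. \<pi> g \<in> bounded_operators K) \<and>
    (\<forall>f\<in>Linf M. \<forall>g\<in>Linf M. (AE x in M. f x = g x) \<longrightarrow> (\<forall>k\<in>K. \<pi> f k = \<pi> g k)) \<and>
    (\<forall>f\<in>Linf M. \<forall>g\<in>Linf M. \<forall>k\<in>K. \<pi> (\<lambda>x. f x + g x) k = \<pi> f k + \<pi> g k) \<and>
    (\<forall>c. \<forall>g\<in>Linf M. \<forall>k\<in>K. \<pi> (\<lambda>x. c * g x) k = c *\<^sub>C \<pi> g k) \<and>
    (\<forall>f\<in>Linf M. \<forall>g\<in>Linf M. \<forall>k\<in>K. \<pi> (\<lambda>x. f x * g x) k = \<pi> f (\<pi> g k)) \<and>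
    (\<forall>k\<in>K. \<pi> (\<lambda>x. 1) k = k)"

definition star_representation ::
    "'x measure \<Rightarrow> (('x \<Rightarrow> complex) \<Rightarrow> 'h \<Rightarrow> 'h) \<Rightarrow> 'h::complex_hilbert set \<Rightarrow> bool"
  where "star_representation M \<pi> K \<longleftrightarrow> Linf_representation M \<pi> K \<and>
    (\<forall>g\<in>Linf M. \<forall>k\<in>K. \<forall>l\<in>K. cinner k (\<pi> (\<lambda>x. cnj (g x)) l) = cinner (\<pi> g k) l)"

definition normal_representation ::
    "'x measure \<Rightarrow> (('x \<Rightarrow> complex) \<Rightarrow> 'h \<Rightarrow> 'h) \<Rightarrow> 'h::complex_hilbert set \<Rightarrow> bool"
  where "normal_representation M \<pi> K \<longleftrightarrow> star_representation M \<pi> K \<and>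
    (\<forall>C. continuous_map (subtopology (weak_star_topology M) (Linf_ball M C))
           (weak_operator_topology K) \<pi>)"

section \<open>Multiplicity functions\<close>

text \<open>All \<open>\<complex>\<^sup>d\<close>, for \<open>d \<le> \<infinity>\<close>, are realised inside the sequences: vectors of \<open>\<complex>\<^sup>d\<close> vanish from
  index \<open>d\<close> on. For \<open>d = \<infinity>\<close> the result is the sequence space \<open>\<ell>\<^sup>2\<close>.\<close>

definition Cdim :: "enat \<Rightarrow> (nat \<Rightarrow> complex) set"
  where "Cdim d = {v. (\<forall>n. d \<le> enat n \<longrightarrow> v n = 0) \<and> summable (\<lambda>n. (cmod (v n))\<^sup>2)}"

definition L2 :: "'x measure \<Rightarrow> ('x \<Rightarrow> enat) \<Rightarrow> ('x \<Rightarrow> nat \<Rightarrow> complex) set"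
  where "L2 M m = {f. (\<forall>n. (\<lambda>x. f x n) \<in> borel_measurable M) \<and>
    (\<forall>x\<in>space M. f x \<in> Cdim (m x)) \<and>
    (\<integral>\<^sup>+x. ennreal (\<Sum>n. (cmod (f x n))\<^sup>2) \<partial>M) < \<infinity>}"

definition L2_inner :: "'x measure \<Rightarrow> ('x \<Rightarrow> nat \<Rightarrow> complex) \<Rightarrow> ('x \<Rightarrow> nat \<Rightarrow> complex) \<Rightarrow> complex"
  where "L2_inner M f g = (LINT x|M. (\<Sum>n. cnj (f x n) * g x n))"

text \<open>A unitary from \<open>K\<close> onto \<open>L\<^sup>2(X, m, \<mu>)\<close>, given by choosing a representative of each image.\<close>

definition unitary_onto_L2 ::
    "'x measure \<Rightarrow> ('x \<Rightarrow> enat) \<Rightarrow> 'h::complex_hilbert set \<Rightarrow> ('h \<Rightarrow> 'x \<Rightarrow> nat \<Rightarrow> complex) \<Rightarrow> bool"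
  where "unitary_onto_L2 M m K J \<longleftrightarrow>
    (\<forall>k\<in>K. J k \<in> L2 M m) \<and>
    (\<forall>k\<in>K. \<forall>l\<in>K. AE x in M. J (k + l) x = (\<lambda>n. J k x n + J l x n)) \<and>
    (\<forall>c. \<forall>k\<in>K. AE x in M. J (c *\<^sub>C k) x = (\<lambda>n. c * J k x n)) \<and>
    (\<forall>k\<in>K. \<forall>l\<in>K. L2_inner M (J k) (J l) = cinner k l) \<and>
    (\<forall>f\<in>L2 M m. \<exists>k\<in>K. AE x in M. J k x = f x)"

text \<open>A multiplicity function is determined only up to a null set, hence a predicate.\<close>

definition is_multiplicity_function ::
    "'x measure \<Rightarrow> (('x \<Rightarrow> complex) \<Rightarrow> 'h \<Rightarrow> 'h) \<Rightarrow> 'h::complex_hilbert set \<Rightarrow> ('x \<Rightarrow> enat) \<Rightarrow> bool"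
  where "is_multiplicity_function M \<pi> K m \<longleftrightarrow>
    m \<in> measurable M (count_space UNIV) \<and>
    (\<exists>J. unitary_onto_L2 M m K J \<and>
      (\<forall>g\<in>Linf M. \<forall>k\<in>K. AE x in M. J (\<pi> g k) x = (\<lambda>n. g x * J k x n)))"

end

theory Submission
  imports Defs
begin

text \<open>Call vectors \<open>k\<^sub>i\<close> in a module over \<open>L\<^sup>\<infinity>\<close>, together with sets \<open>A\<^sub>i\<close>, a frame if
  \<open>\<langle>k\<^sub>i | \<pi>(g) k\<^sub>j\<rangle>\<close> is the integral of \<open>g\<close> over \<open>A\<^sub>i\<close> for \<open>i = j\<close> and \<open>0\<close> otherwise, and only \<open>0\<close> is
  orthogonal to all \<open>\<pi>(g) k\<^sub>i\<close>. If \<open>c\<^sub>i\<^sub>j\<close> are the densities of \<open>\<langle>k\<^sub>i | \<pi>(g) l\<^sub>j\<rangle>\<close> for two frames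
  \<open>(k, A)\<close> and \<open>(l, B)\<close>, Parseval's identity shows that \<open>\<Sum>\<^sub>i |c\<^sub>i\<^sub>j|\<^sup>2\<close> is the indicator of \<open>B\<^sub>j\<close> and
  \<open>\<Sum>\<^sub>j |c\<^sub>i\<^sub>j|\<^sup>2\<close> that of \<open>A\<^sub>i\<close>, so almost every point lies in equally many \<open>A\<^sub>i\<close> and \<open>B\<^sub>j\<close>. The
  coordinate sections of \<open>L\<^sup>2(X, m, \<mu>)\<close> form a frame for which this number is \<open>m\<close>.

  Strong invariance and countable separation provide a countable measurable partition into sets
  \<open>E\<^sub>e\<close> on which \<open>r\<close> is injective and such that the fibres through \<open>E\<^sub>e\<close> have constant cardinality
  \<open>c\<^sub>e\<close>. A frame \<open>(k, A)\<close> of \<open>V\<^sub>0\<close> then yields a frame of \<open>V\<^sub>1\<close>: the preimages under the dilated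
  isometry of \<open>k\<^sub>n\<close> multiplied by \<open>\<surd>c\<^sub>e\<close> and by the indicator of \<open>E\<^sub>e\<close>, with the sets \<open>r(E\<^sub>e \<inter> A\<^sub>n)\<close>.
  These cover \<open>x\<close> as often as the \<open>A\<^sub>n\<close> cover its fibre. For (ii), the frames of \<open>V\<^sub>0\<close> and \<open>W\<^sub>0\<close>
  together form another frame of \<open>V\<^sub>1\<close>.\<close>

section \<open>Complex inner products\<close>

lemma cinner_zero_right [simp]: "cinner x 0 = 0"
  using cinner_add_right[of x 0 0] by simp

lemma cinner_zero_left [simp]: "cinner 0 x = 0"
  by (metis cinner_commute cinner_zero_right complex_cnj_zero)

lemma cinner_scaleC_left: "cinner (c *\<^sub>C x) y = cnj c * cinner x y"
  by (metis cinner_commute cinner_scaleC_right complex_cnj_mult)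

lemma cinner_diff_right: "cinner x (y - z) = cinner x y - cinner x z"
  using cinner_add_right[of x "y - z" z] by (simp add: algebra_simps)

lemma cinner_self: "cinner x x = of_real ((norm x)\<^sup>2)"
proof -
  have "Im (cinner x x) = 0"
    using cinner_commute[of x x] by (metis Reals_cnj_iff complex_is_Real_iff)
  then show ?thesis
    by (simp add: complex_eq_iff power2_norm_eq_inner inner_eq_Re_cinner)
qed

text \<open>Turns real orthogonality to a complex subspace into complex orthogonality, since such a
  subspace contains \<open>\<i> *\<^sub>C x\<close> along with \<open>x\<close>.\<close>

lemma Im_cinner: "Im (cinner x y) = (\<i> *\<^sub>C x) \<bullet> y"
  by (simp add: inner_eq_Re_cinner cinner_scaleC_left)

lemma norm_scaleC: "norm (c *\<^sub>C x) = cmod c * norm x"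
proof -
  have "complex_of_real ((norm (c *\<^sub>C x))\<^sup>2) = (c * cnj c) * of_real ((norm x)\<^sup>2)"
    unfolding cinner_self[symmetric] cinner_scaleC_left cinner_scaleC_right
    by (simp only: mult.assoc mult.commute[of "cnj c"])
  also have "\<dots> = of_real ((cmod c * norm x)\<^sup>2)"
    unfolding complex_norm_square[symmetric] power_mult_distrib by (simp only: of_real_mult)
  finally have "(norm (c *\<^sub>C x))\<^sup>2 = (cmod c * norm x)\<^sup>2"
    by (simp only: of_real_eq_iff)
  then show ?thesis by simp
qed

text \<open>A unimodular factor \<open>a\<close> rotates the inner product onto the nonnegative real
  axis, where the real Cauchy-Schwarz inequality applies.\<close>

lemma cinner_le_norm: "cmod (cinner x y) \<le> norm x * norm y"
proof (cases "cinner x y = 0")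
  case False
  define a where "a = cnj (cinner x y) / cmod (cinner x y)"
  have a: "cmod a = 1" using False by (simp add: a_def norm_divide)
  have "cinner x (a *\<^sub>C y) = of_real (cmod (cinner x y))"
    using False by (simp add: cinner_scaleC_right a_def mult.commute[of "cnj _"] complex_norm_square[symmetric] power2_eq_square)
  then have "cmod (cinner x y) = x \<bullet> (a *\<^sub>C y)"
    by (simp add: inner_eq_Re_cinner)
  also have "\<dots> \<le> norm x * norm (a *\<^sub>C y)" by (rule norm_cauchy_schwarz)
  finally show ?thesis using a by (simp add: norm_scaleC)
qed simp

lemma bounded_linear_cinner_right: "bounded_linear (cinner x)"
proof (rule bounded_linear_intro)
  show "cinner x (r *\<^sub>R y) = r *\<^sub>R cinner x y" for r y
    by (subst scaleR_scaleC) (simp add: cinner_scaleC_right scaleR_conv_of_real)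
  show "norm (cinner x y) \<le> norm y * norm x" for y
    using cinner_le_norm[of x y] by (simp add: mult.commute)
qed (simp add: cinner_add_right)

lemma csubspace_scaleR: "csubspace K \<Longrightarrow> x \<in> K \<Longrightarrow> a *\<^sub>R x \<in> K"
  by (simp add: scaleR_scaleC complex_vector.subspace_scale)

text \<open>The second assumption says that \<open>u i\<close> is the projection of \<open>v\<close>
  onto the line through \<open>u i\<close>. Bessel's inequality then makes the squared norms
  summable, completeness gives convergence of the series itself, and Pythagoras passes to the
  limit.\<close>

lemma orthogonal_projections_sums:
  fixes u :: "nat \<Rightarrow> 'h::complex_hilbert"
  assumes orth: "\<And>i j. i \<noteq> j \<Longrightarrow> cinner (u i) (u j) = 0"
    and proj: "\<And>i. cinner (u i) v = cinner (u i) (u i)"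
  obtains s where "u sums s" "(\<lambda>i. (norm (u i))\<^sup>2) sums (norm s)\<^sup>2"
proof -
  have o: "u i \<bullet> u j = (if i = j then (norm (u i))\<^sup>2 else 0)" for i j
    using orth[of i j] by (auto simp: inner_eq_Re_cinner power2_norm_eq_inner)
  have p: "u i \<bullet> v = (norm (u i))\<^sup>2" for i
    using proj[of i] by (simp add: inner_eq_Re_cinner power2_norm_eq_inner)
  have nrm: "(norm (sum u I))\<^sup>2 = (\<Sum>i\<in>I. (norm (u i))\<^sup>2)" if "finite I" for I
    unfolding power2_norm_eq_inner[of "sum u I"] inner_sum_left inner_sum_right o
    using that by simp
  \<comment> \<open>Bessel's inequality, from expanding the squared norm of
    \<open>v - sum u I\<close>.\<close>
  have "(\<Sum>i\<in>I. (norm (u i))\<^sup>2) \<le> (norm v)\<^sup>2" if "finite I" for I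
  proof -
    have "(norm (v - sum u I))\<^sup>2 = (norm v)\<^sup>2 - 2 * (sum u I \<bullet> v) + (norm (sum u I))\<^sup>2"
      unfolding power2_norm_eq_inner inner_diff_left inner_diff_right
      using inner_commute[of v "sum u I"] by linarith
    also have "sum u I \<bullet> v = (\<Sum>i\<in>I. (norm (u i))\<^sup>2)"
      by (simp add: inner_sum_left p)
    finally show ?thesis
      using nrm[OF that] zero_le_power2[of "norm (v - sum u I)"] by linarith
  qed
  then have sm: "summable (\<lambda>i. (norm (u i))\<^sup>2)"
    by (intro summableI_nonneg_bounded[of _ "(norm v)\<^sup>2"]) auto
  have "Cauchy (\<lambda>n. sum u {..<n})"
  proof (rule CauchyI')
    fix e :: real assume "e > 0"
    then have "e\<^sup>2 > 0" by simp
    with sm obtain N where N: "\<And>m n. m \<ge> N \<Longrightarrow> norm (\<Sum>i\<in>{m..<n}. (norm (u i))\<^sup>2) < e\<^sup>2"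
      unfolding summable_Cauchy by blast
    show "\<exists>N. \<forall>m\<ge>N. \<forall>n>m. dist (sum u {..<m}) (sum u {..<n}) < e"
    proof (intro exI[of _ N] allI impI)
      fix m n assume "N \<le> m" "m < n"
      from N[OF this(1), of n] have "(norm (sum u {m..<n}))\<^sup>2 < e\<^sup>2"
        by (simp add: nrm sum_nonneg)
      moreover have "sum u {..<n} = sum u {..<m} + sum u {m..<n}"
        using sum.atLeastLessThan_concat[of 0 m n u] \<open>m < n\<close> by (simp add: lessThan_atLeast0)
      ultimately show "dist (sum u {..<m}) (sum u {..<n}) < e"
        using \<open>e > 0\<close> by (simp add: dist_norm power2_less_imp_less)
    qed
  qed
  then have "summable u"
    by (simp add: Cauchy_convergent summable_iff_convergent)
  then obtain s where s: "u sums s" by (auto simp: summable_def)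
  have "(\<lambda>n. (norm (sum u {..<n}))\<^sup>2) \<longlonglongrightarrow> (norm s)\<^sup>2"
    using s by (auto simp: sums_def intro!: tendsto_intros)
  then have "(\<lambda>i. (norm (u i))\<^sup>2) sums (norm s)\<^sup>2"
    by (simp add: sums_def nrm)
  with s show thesis by (rule that)
qed

text \<open>Testing a density against its conjugate phase, a function bounded by 1, integrates its
  modulus. Zeros make no exception, as \<open>sgn\<close> is 0 there.\<close>

lemma cnj_sgn_mult: "cnj (sgn z) * z = complex_of_real (cmod z)"
proof -
  have "sgn z * cmod z = z"
    by (simp add: sgn_eq)
  then have "cnj (sgn z) * z = sgn z * cnj (sgn z) * cmod z"
    by (metis mult.assoc mult.commute)
  also have "\<dots> = of_real ((cmod (sgn z))\<^sup>2 * cmod z)"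
    by (simp only: complex_norm_square of_real_mult)
  finally show ?thesis
    by (simp add: norm_sgn split: if_splits)
qed

section \<open>Essentially bounded functions\<close>

lemma borel_measurable_cnj: "f \<in> borel_measurable M \<Longrightarrow> (\<lambda>x. cnj (f x)) \<in> borel_measurable M"
  by (rule borel_measurable_continuous_on[of cnj]) (auto intro: continuous_intros)

lemma Linf_intro:
  "g \<in> borel_measurable M \<Longrightarrow> (\<And>x. x \<in> space M \<Longrightarrow> cmod (g x) \<le> C) \<Longrightarrow> g \<in> Linf M"
  by (auto simp: Linf_def)

lemma Linf_const [simp]: "(\<lambda>x. c) \<in> Linf M"
  by (auto intro: Linf_intro)

lemma Linf_indicator [simp]: "A \<in> sets M \<Longrightarrow> indicator A \<in> Linf M"
  by (rule Linf_intro[where C=1]) (auto split: split_indicator)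

lemma Linf_mult [simp]: assumes "f \<in> Linf M" "g \<in> Linf M" shows "(\<lambda>x. f x * g x) \<in> Linf M"
proof -
  from assms obtain C D where "AE x in M. cmod (f x) \<le> C" "AE x in M. cmod (g x) \<le> D"
    by (auto simp: Linf_def)
  then have "AE x in M. cmod (f x * g x) \<le> C * D"
    by eventually_elim (auto simp: norm_mult intro!: mult_mono intro: order_trans[OF norm_ge_zero])
  with assms show ?thesis by (auto simp: Linf_def)
qed

lemma Linf_cnj [simp]: "f \<in> Linf M \<Longrightarrow> (\<lambda>x. cnj (f x)) \<in> Linf M"
  by (auto simp: Linf_def intro!: borel_measurable_cnj)

lemma Linf_measurable: "f \<in> Linf M \<Longrightarrow> f \<in> borel_measurable M"
  by (auto simp: Linf_def)

lemma integrable_Linf_mult: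
  assumes "g \<in> Linf M" "integrable M d" shows "integrable M (\<lambda>x. g x * d x)"
proof -
  from assms obtain C where C: "AE x in M. cmod (g x) \<le> C" by (auto simp: Linf_def)
  show ?thesis
  proof (rule Bochner_Integration.integrable_bound[of M "\<lambda>x. C *\<^sub>R d x"])
    show "AE x in M. norm (g x * d x) \<le> norm (C *\<^sub>R d x)"
      using C
    proof eventually_elim
      case (elim x)
      then have "cmod (g x) \<le> \<bar>C\<bar>" by linarith
      then show ?case by (simp add: norm_mult mult_right_mono)
    qed
  qed (use assms in \<open>auto simp: Linf_def\<close>)
qed

lemma (in prob_space) integrable_Linf: "g \<in> Linf M \<Longrightarrow> integrable M g"
  using integrable_Linf_mult[of g M "\<lambda>x. 1"] by simp

text \<open>The conjugate phase of \<open>d\<close> is an admissible \<open>g\<close>, and its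
  integral against \<open>d\<close> is that of \<open>cmod (d x)\<close>.\<close>

lemma AE_eq_zero_if_orthogonal_bounded:
  assumes d: "integrable M d"
    and 0: "\<And>g. g \<in> borel_measurable M \<Longrightarrow> (\<And>x. cmod (g x) \<le> 1) \<Longrightarrow> (LINT x|M. g x * d x) = (0::complex)"
  shows "AE x in M. d x = 0"
proof -
  have "(LINT x|M. cnj (sgn (d x)) * d x) = 0"
    using d by (intro 0 borel_measurable_cnj borel_measurable_sgn) (simp_all add: norm_sgn)
  then have "(LINT x|M. cmod (d x)) = 0"
    by (simp add: cnj_sgn_mult)
  then show ?thesis
    using integral_nonneg_eq_0_iff_AE[of M "\<lambda>x. cmod (d x)"] d by simp
qed

text \<open>If \<open>g x < f x\<close> on a set of positive measure, the integral of
  \<open>f\<close> over that set strictly exceeds that of \<open>g\<close>, which is finite; this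
  contradicts \<open>le\<close>.\<close>

lemma AE_le_if_nn_integral_le:
  fixes f g :: "'x \<Rightarrow> ennreal"
  assumes [measurable]: "f \<in> borel_measurable M" "g \<in> borel_measurable M"
    and fin: "(\<integral>\<^sup>+x. g x \<partial>M) < \<infinity>"
    and le: "\<And>B. B \<in> sets M \<Longrightarrow> (\<integral>\<^sup>+x. f x * indicator B x \<partial>M) \<le> (\<integral>\<^sup>+x. g x * indicator B x \<partial>M)"
  shows "AE x in M. f x \<le> g x"
proof -
  let ?B = "{x\<in>space M. g x < f x}"
  have B[measurable]: "?B \<in> sets M" by measurable
  have lt: "(\<integral>\<^sup>+x. g x * indicator ?B x \<partial>M) < \<infinity>"
    by (rule le_less_trans[OF nn_integral_mono fin]) (auto split: split_indicator)
  have "AE x in M. f x * indicator ?B x \<le> g x * indicator ?B x"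
  proof (rule ccontr)
    assume n: "\<not> ?thesis"
    have "(\<integral>\<^sup>+x. g x * indicator ?B x \<partial>M) < (\<integral>\<^sup>+x. f x * indicator ?B x \<partial>M)"
      by (rule nn_integral_less) (use lt n in \<open>auto split: split_indicator\<close>)
    with le[OF B] show False by simp
  qed
  then show ?thesis
    by (rule AE_mp) (auto simp: not_less split: split_indicator intro!: AE_I2)
qed

section \<open>Orthonormal frames of a representation\<close>

text \<open>Normality enters through the densities of the coefficients. For a module with a
  multiplicity function they come from its realisation as \<open>L2 M m\<close>.\<close>

locale Linf_module = prob_space M for M :: "'x measure" +
  fixes \<pi> :: "('x \<Rightarrow> complex) \<Rightarrow> 'h \<Rightarrow> 'h::complex_hilbert" and K :: "'h set"
  assumes star: "star_representation M \<pi> K"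
    and subspace: "csubspace K" and closed: "closed K"
    and density: "\<And>k l. k \<in> K \<Longrightarrow> l \<in> K \<Longrightarrow>
      \<exists>d. integrable M d \<and> (\<forall>g\<in>Linf M. cinner k (\<pi> g l) = (LINT x|M. g x * d x))"
begin

text \<open>\<open>d\<close> is the Radon-Nikodym derivative of the complex measure
  \<open>A \<mapsto> cinner k (\<pi> (indicator A) l)\<close>. In a realisation as
  \<open>L2 M m\<close> it is the fibrewise inner product of \<open>k\<close> and
  \<open>l\<close>.\<close>

definition has_density :: "'h \<Rightarrow> 'h \<Rightarrow> ('x \<Rightarrow> complex) \<Rightarrow> bool" where
  "has_density k l d \<longleftrightarrow> integrable M d \<and> (\<forall>g\<in>Linf M. cinner k (\<pi> g l) = (LINT x|M. g x * d x))"

text \<open>At almost every \<open>x\<close>, the \<open>k i\<close> with \<open>x\<close> in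
  \<open>A i\<close> form an orthonormal basis of the fibre, while the other \<open>k i\<close>
  vanish. The sets need not be nested, so that frames can be transported and merged.\<close>

definition frame :: "(nat \<Rightarrow> 'h) \<Rightarrow> (nat \<Rightarrow> 'x set) \<Rightarrow> bool" where
  "frame k A \<longleftrightarrow> (\<forall>i. k i \<in> K \<and> A i \<in> sets M) \<and>
    (\<forall>i j. has_density (k i) (k j) (if i = j then indicator (A i) else (\<lambda>x. 0))) \<and>
    (\<forall>v\<in>K. (\<forall>i. \<forall>g\<in>Linf M. cinner (\<pi> g (k i)) v = 0) \<longrightarrow> v = 0)"

section \<open>Adjoints, norms and coefficients in a module\<close>

lemma ex_has_density: "k \<in> K \<Longrightarrow> l \<in> K \<Longrightarrow> \<exists>d. has_density k l d"
  using density unfolding has_density_def by blast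

lemma has_densityD: "has_density k l d \<Longrightarrow> g \<in> Linf M \<Longrightarrow> cinner k (\<pi> g l) = (LINT x|M. g x * d x)"
  by (simp add: has_density_def)

lemma has_density_integrable: "has_density k l d \<Longrightarrow> integrable M d"
  by (simp add: has_density_def)

lemma rep_in [simp]: "g \<in> Linf M \<Longrightarrow> k \<in> K \<Longrightarrow> \<pi> g k \<in> K"
  using star unfolding star_representation_def Linf_representation_def bounded_operators_def by blast

lemma rep_mult:
  assumes "f \<in> Linf M" "g \<in> Linf M" "k \<in> K"
  shows "\<pi> (\<lambda>x. f x * g x) k = \<pi> f (\<pi> g k)"
proof -
  have "\<forall>f\<in>Linf M. \<forall>g\<in>Linf M. \<forall>k\<in>K. \<pi> (\<lambda>x. f x * g x) k = \<pi> f (\<pi> g k)"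
    using star unfolding star_representation_def Linf_representation_def by blast
  with assms show ?thesis by blast
qed

lemma cinner_rep_left:
  assumes "f \<in> Linf M" "k \<in> K" "l \<in> K"
  shows "cinner (\<pi> f k) l = cinner k (\<pi> (\<lambda>x. cnj (f x)) l)"
proof -
  have "\<forall>g\<in>Linf M. \<forall>k\<in>K. \<forall>l\<in>K. cinner k (\<pi> (\<lambda>x. cnj (g x)) l) = cinner (\<pi> g k) l"
    using star unfolding star_representation_def by blast
  with assms have "cinner k (\<pi> (\<lambda>x. cnj (f x)) l) = cinner (\<pi> f k) l" by blast
  then show ?thesis by (rule sym)
qed

lemma cinner_rep_rep:
  assumes "f \<in> Linf M" "g \<in> Linf M" "k \<in> K" "l \<in> K"
  shows "cinner (\<pi> f k) (\<pi> g l) = cinner k (\<pi> (\<lambda>x. cnj (f x) * g x) l)"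
  unfolding rep_mult[OF Linf_cnj[OF assms(1)] assms(2,4)]
  by (rule cinner_rep_left[OF assms(1,3) rep_in[OF assms(2,4)]])

lemma norm_rep:
  assumes "g \<in> Linf M" "k \<in> K" "B \<in> sets M"
    and k: "has_density k k (indicator B)"
  shows "(norm (\<pi> g k))\<^sup>2 = (LINT x|M. (cmod (g x))\<^sup>2 * indicator B x)"
proof -
  have "complex_of_real ((norm (\<pi> g k))\<^sup>2) = (LINT x|M. cnj (g x) * g x * indicator B x)"
    using assms unfolding cinner_self[symmetric] by (simp add: cinner_rep_rep has_densityD)
  also have "\<dots> = (LINT x|M. complex_of_real ((cmod (g x))\<^sup>2 * indicator B x))"
    by (intro Bochner_Integration.integral_cong refl)
      (simp del: of_real_power add: complex_norm_square mult.commute split: split_indicator)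
  finally have "complex_of_real ((norm (\<pi> g k))\<^sup>2) = of_real (LINT x|M. (cmod (g x))\<^sup>2 * indicator B x)"
    by (simp only: integral_complex_of_real)
  then show ?thesis by (simp only: of_real_eq_iff)
qed

lemma Linf_square_integrable:
  assumes "g \<in> Linf M" "B \<in> sets M" shows "integrable M (\<lambda>x. (cmod (g x))\<^sup>2 * indicator B x :: real)"
proof -
  have "integrable M (\<lambda>x. cmod (g x * cnj (g x) * indicator B x))"
    using assms by (intro integrable_norm integrable_Linf) simp
  moreover have "cmod (g x * cnj (g x) * indicator B x) = (cmod (g x))\<^sup>2 * indicator B x" for x
    by (simp add: norm_mult power2_eq_square split: split_indicator)
  ultimately show ?thesis by simp
qed

text \<open>The Cauchy-Schwarz inequality for \<open>\<pi> (indicator D) x\<close> and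
  \<open>\<pi> ?s y\<close>, where \<open>?s\<close> is the conjugate phase of \<open>c\<close> cut
  off to \<open>D\<close>: their inner product is the integral of the modulus of \<open>c\<close>
  over \<open>D\<close>.\<close>

lemma set_integral_coefficient_le:
  assumes x: "x \<in> K" "A \<in> sets M" "has_density x x (indicator A)"
    and y: "y \<in> K" "B \<in> sets M" "has_density y y (indicator B)"
    and c: "has_density x y c"
    and D: "D \<in> sets M"
  shows "(LINT t|M. cmod (c t) * indicator D t) \<le> sqrt (prob (D \<inter> A)) * sqrt (prob (D \<inter> B))"
proof -
  let ?s = "\<lambda>t. cnj (sgn (c t)) * indicator D t"
  have s: "(\<lambda>t. cnj (sgn (c t))) \<in> Linf M"
    using has_density_integrable[OF c] by (intro Linf_intro[where C=1]) (auto simp: norm_sgn intro!: borel_measurable_cnj borel_measurable_sgn)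
  have s': "?s \<in> Linf M" using s D by (intro Linf_mult Linf_indicator)
  have iD: "indicator D \<in> Linf M" using D by simp
  have "cinner (\<pi> (indicator D) x) (\<pi> ?s y) = (LINT t|M. (cnj (indicator D t) * ?s t) * c t)"
    using s' D x y by (simp add: cinner_rep_rep has_densityD[OF c])
  also have "\<dots> = (LINT t|M. complex_of_real (cmod (c t) * indicator D t))"
  proof (intro Bochner_Integration.integral_cong refl)
    fix t
    show "(cnj (indicator D t) * ?s t) * c t = complex_of_real (cmod (c t) * indicator D t)"
      by (simp add: cnj_sgn_mult split: split_indicator)
  qed
  finally have "complex_of_real (LINT t|M. cmod (c t) * indicator D t) = cinner (\<pi> (indicator D) x) (\<pi> ?s y)"
    by (simp only: integral_complex_of_real)
  then have "\<bar>LINT t|M. cmod (c t) * indicator D t\<bar> = cmod (cinner (\<pi> (indicator D) x) (\<pi> ?s y))"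
    by (metis norm_of_real)
  then have "(LINT t|M. cmod (c t) * indicator D t) \<le> norm (\<pi> (indicator D) x) * norm (\<pi> ?s y)"
    using cinner_le_norm[of "\<pi> (indicator D) x" "\<pi> ?s y"] by linarith
  also have "\<dots> \<le> sqrt (prob (D \<inter> A)) * sqrt (prob (D \<inter> B))"
  proof (intro mult_mono)
    have "(norm (\<pi> (indicator D) x))\<^sup>2 = (LINT t|M. indicator (D \<inter> A) t)"
      unfolding norm_rep[OF iD x]
      by (intro Bochner_Integration.integral_cong refl) (simp split: split_indicator)
    also have "\<dots> = prob (D \<inter> A)" using D x(2) by simp
    finally show "norm (\<pi> (indicator D) x) \<le> sqrt (prob (D \<inter> A))"
      by (intro real_le_rsqrt) simp
    have "(norm (\<pi> ?s y))\<^sup>2 \<le> (LINT t|M. indicator (D \<inter> B) t)"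
      unfolding norm_rep[OF s' y]
    proof (rule integral_mono)
      show "integrable M (\<lambda>t. (cmod (?s t))\<^sup>2 * indicator B t)"
        using s' y(2) by (rule Linf_square_integrable)
      show "integrable M (indicator (D \<inter> B) :: _ \<Rightarrow> real)"
        using D y(2) by (simp add: less_top[symmetric])
    qed (auto simp: norm_mult norm_sgn split: split_indicator)
    also have "\<dots> = prob (D \<inter> B)" using D y(2) by simp
    finally show "norm (\<pi> ?s y) \<le> sqrt (prob (D \<inter> B))"
      by (intro real_le_rsqrt)
  qed auto
  finally show ?thesis .
qed

text \<open>The pointwise form of the Cauchy-Schwarz inequality. As \<open>D\<close> is arbitrary in
  the integrated bound, the modulus of \<open>c\<close> is at most 1; taking \<open>D\<close>
  disjoint from \<open>A\<close> or from \<open>B\<close> shows that \<open>c\<close> vanishes off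
  either set.\<close>

lemma coefficient_bounds:
  assumes x: "x \<in> K" "A \<in> sets M" "has_density x x (indicator A)"
    and y: "y \<in> K" "B \<in> sets M" "has_density y y (indicator B)"
    and c: "has_density x y c"
  shows "c \<in> Linf M" "AE t in M. c t * indicator A t = c t" "AE t in M. c t * indicator B t = c t"
proof -
  note ic = has_density_integrable[OF c]
  note le = set_integral_coefficient_le[OF x y c]
  have nn: "(\<integral>\<^sup>+t. ennreal (cmod (c t)) * indicator D t \<partial>M) = ennreal (LINT t|M. cmod (c t) * indicator D t)"
    if "D \<in> sets M" for D
    using nn_integral_eq_integral[of M "\<lambda>t. cmod (c t) * indicator D t"] ic that
    by (simp add: integrable_real_mult_indicator ennreal_mult' ennreal_indicator)
  have [measurable]: "c \<in> borel_measurable M" using ic by simp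
  have "AE t in M. ennreal (cmod (c t)) \<le> 1"
  proof (rule AE_le_if_nn_integral_le)
    fix D assume D: "D \<in> sets M"
    have "sqrt (prob (D \<inter> A)) * sqrt (prob (D \<inter> B)) \<le> sqrt (prob D) * sqrt (prob D)"
      using D by (intro mult_mono real_sqrt_le_mono finite_measure_mono) auto
    with le[OF D] have "(LINT t|M. cmod (c t) * indicator D t) \<le> prob D"
      by simp
    then show "(\<integral>\<^sup>+t. ennreal (cmod (c t)) * indicator D t \<partial>M) \<le> (\<integral>\<^sup>+t. 1 * indicator D t \<partial>M)"
      using D by (simp add: nn emeasure_eq_measure ennreal_leI)
  qed (auto simp: emeasure_space_1)
  then have "AE t in M. cmod (c t) \<le> 1" by (simp add: ennreal_le_1)
  then show "c \<in> Linf M" by (auto simp: Linf_def)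
  have vanish: "AE t in M. c t * indicator E t = c t"
    if E: "E \<in> sets M" and AB: "E = A \<or> E = B" for E
  proof -
    have "AE t in M. ennreal (cmod (c t)) * indicator (space M - E) t \<le> 0"
    proof (rule AE_le_if_nn_integral_le)
      fix D assume D: "D \<in> sets M"
      have "sqrt (prob ((D - E) \<inter> A)) * sqrt (prob ((D - E) \<inter> B)) = 0"
      proof -
        have "(D - E) \<inter> A = {} \<or> (D - E) \<inter> B = {}" using AB by blast
        then show ?thesis by (elim disjE) simp_all
      qed
      then have "(\<integral>\<^sup>+t. ennreal (cmod (c t)) * indicator (D - E) t \<partial>M) \<le> 0"
        using D E le[of "D - E"] nn[of "D - E"] by (simp only: sets.Diff ennreal_neg)
      also have "(\<integral>\<^sup>+t. ennreal (cmod (c t)) * indicator (D - E) t \<partial>M) =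
        (\<integral>\<^sup>+t. ennreal (cmod (c t)) * indicator (space M - E) t * indicator D t \<partial>M)"
        using D sets.sets_into_space by (intro nn_integral_cong) (auto split: split_indicator)
      finally show "(\<integral>\<^sup>+t. ennreal (cmod (c t)) * indicator (space M - E) t * indicator D t \<partial>M)
        \<le> (\<integral>\<^sup>+t. 0 * indicator D t \<partial>M)" by simp
    next
      show "(\<lambda>t. ennreal (cmod (c t)) * indicator (space M - E) t) \<in> borel_measurable M"
        using E by measurable
    qed simp_all
    then show ?thesis
      by (rule AE_mp) (auto split: split_indicator intro!: AE_I2)
  qed
  show "AE t in M. c t * indicator A t = c t" "AE t in M. c t * indicator B t = c t"
    using vanish x(2) y(2) by auto
qed

text \<open>Expanding the part of \<open>l\<close> over \<open>D\<close> along the frame and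
  comparing norms gives equal integrals of both sides over \<open>D\<close>. As \<open>D\<close> is
  arbitrary, the integrands agree almost everywhere.\<close>

lemma frame_parseval:
  assumes fr: "frame k A" and l: "l \<in> K" "B \<in> sets M"
      "has_density l l (indicator B)"
    and c: "\<And>i. c i \<in> Linf M" "\<And>i. AE x in M. c i x * indicator (A i) x = c i x"
      "\<And>i. has_density (k i) l (c i)"
  shows "AE x in M. (\<Sum>i. ennreal ((cmod (c i x))\<^sup>2)) = indicator B x"
proof (rule density_unique2)
  have k: "k i \<in> K" and A: "A i \<in> sets M" for i using fr by (auto simp: frame_def)
  have kk: "cinner (k i) (\<pi> g (k j)) = (if i = j then LINT x|M. g x * indicator (A i) x else 0)"
    if "g \<in> Linf M" for i j g
    using fr that has_densityD[of "k i" "k j" _ g] by (cases "i = j") (force simp: frame_def)+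
  have [measurable]: "c i \<in> borel_measurable M" for i using c(1) by (rule Linf_measurable)
  show "(\<lambda>x. \<Sum>i. ennreal ((cmod (c i x))\<^sup>2)) \<in> borel_measurable M" by measurable
  show "indicator B \<in> borel_measurable M" using l by simp
  fix D assume D[measurable]: "D \<in> sets M"
  note Linf_measurable[measurable]
  define v where "v = \<pi> (indicator D) l"
  \<comment> \<open>The projection of \<open>v\<close> onto the closed submodule generated by
    \<open>k i\<close>: fibrewise, the multiple of \<open>k i\<close> by the coefficient
    \<open>c i\<close> over \<open>D\<close>.\<close>
  define u where "u i = \<pi> (\<lambda>x. indicator D x * c i x) (k i)" for i
  have Dc: "(\<lambda>x. indicator D x * c i x) \<in> Linf M" for i using D c by simp
  have iD: "indicator D \<in> Linf M" using D by simp
  have v: "v \<in> K" using iD l by (simp add: v_def)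
  have u: "u i \<in> K" for i using Dc k by (simp add: u_def)
  have u_u: "cinner (\<pi> g (k i)) (u j) =
      (if i = j then LINT x|M. cnj (g x) * (indicator D x * c i x) else 0)" if "g \<in> Linf M" for g i j
  proof -
    \<comment> \<open>Since \<open>c i\<close> vanishes off \<open>A i\<close>, the indicator of
      \<open>A i\<close> drops out, and \<open>u i\<close> has the same coefficients against
      \<open>k i\<close> as \<open>v\<close>.\<close>
    have "(LINT x|M. cnj (g x) * (indicator D x * c i x) * indicator (A i) x)
       = (LINT x|M. cnj (g x) * (indicator D x * c i x))"
      using c(2)[of i] A[of i] D that
      by (intro integral_cong_AE) (auto elim!: eventually_mono intro!: borel_measurable_cnj borel_measurable_times Linf_measurable Dc split: split_indicator)
    then show ?thesis
      using that Dc k by (cases "i = j") (simp_all add: u_def cinner_rep_rep kk)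
  qed
  have u_v: "cinner (\<pi> g (k i)) v = (LINT x|M. cnj (g x) * (indicator D x * c i x))" if "g \<in> Linf M" for g i
    using that iD k l by (simp add: v_def cinner_rep_rep has_densityD[OF c(3)] mult.assoc)
  obtain s where s: "u sums s" "(\<lambda>i. (norm (u i))\<^sup>2) sums (norm s)\<^sup>2"
  proof (rule orthogonal_projections_sums[of u v])
    show "cinner (u i) (u j) = 0" if "i \<noteq> j" for i j
      using u_u[OF Dc, of i i j] that unfolding u_def[symmetric] by simp
    show "cinner (u i) v = cinner (u i) (u i)" for i
      using u_v[OF Dc, of i i] u_u[OF Dc, of i i i] unfolding u_def[symmetric] by simp
  qed
  have "s \<in> K"
  proof (rule closed_sequentially[OF closed])
    show "(\<lambda>n. sum u {..<n}) \<longlonglongrightarrow> s" using s(1) by (simp add: sums_def)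
    show "sum u {..<n} \<in> K" for n
      using u by (intro complex_vector.subspace_sum[OF subspace])
  qed
  \<comment> \<open>The sum of the projections has the same coefficients as \<open>v\<close>, so
    completeness of the frame forces \<open>v = s\<close>.\<close>
  moreover have "cinner (\<pi> g (k i)) (v - s) = 0" if g: "g \<in> Linf M" for g i
  proof -
    have "(\<lambda>j. cinner (\<pi> g (k i)) (u j)) sums cinner (\<pi> g (k i)) s"
      by (rule bounded_linear.sums[OF bounded_linear_cinner_right s(1)])
    moreover have "(\<lambda>j. cinner (\<pi> g (k i)) (u j)) sums cinner (\<pi> g (k i)) v"
      using sums_single[of i "\<lambda>j. cinner (\<pi> g (k i)) v"] unfolding u_u[OF g] u_v[OF g]
      by (simp only: eq_commute[of i])
    ultimately have "cinner (\<pi> g (k i)) s = cinner (\<pi> g (k i)) v" by (rule sums_unique2)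
    then show ?thesis by (simp add: cinner_diff_right)
  qed
  ultimately have "v - s = 0"
    using fr v complex_vector.subspace_diff[OF subspace] unfolding frame_def by blast
  then have vs: "(\<lambda>i. (norm (u i))\<^sup>2) sums (norm v)\<^sup>2" using s(2) by simp
  have nu: "ennreal ((norm (u i))\<^sup>2) = (\<integral>\<^sup>+x. ennreal ((cmod (c i x))\<^sup>2) * indicator D x \<partial>M)" for i
  proof -
    have "(norm (u i))\<^sup>2 = (LINT x|M. (cmod (indicator D x * c i x))\<^sup>2 * indicator (A i) x)"
      unfolding u_def using fr by (intro norm_rep[OF Dc k A]) (auto simp: frame_def dest: spec2[of _ i i])
    then have "ennreal ((norm (u i))\<^sup>2) = (\<integral>\<^sup>+x. ennreal ((cmod (indicator D x * c i x))\<^sup>2 * indicator (A i) x) \<partial>M)"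
      using nn_integral_eq_integral[OF Linf_square_integrable[OF Dc A]] by simp
    also have "\<dots> = (\<integral>\<^sup>+x. ennreal ((cmod (c i x))\<^sup>2) * indicator D x \<partial>M)"
      using c(2)[of i] by (intro nn_integral_cong_AE) (auto elim!: eventually_mono split: split_indicator)
    finally show ?thesis .
  qed
  have "ennreal ((norm v)\<^sup>2) = (\<integral>\<^sup>+x. ennreal ((cmod (indicator D x))\<^sup>2 * indicator B x) \<partial>M)"
    using nn_integral_eq_integral[OF Linf_square_integrable[OF iD l(2)]]
    unfolding v_def norm_rep[OF iD l] by simp
  also have "\<dots> = (\<integral>\<^sup>+x. indicator B x * indicator D x \<partial>M)"
    by (intro nn_integral_cong) (auto split: split_indicator)
  finally have nv: "ennreal ((norm v)\<^sup>2) = (\<integral>\<^sup>+x. indicator B x * indicator D x \<partial>M)" .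
  have "(\<integral>\<^sup>+x. (\<Sum>i. ennreal ((cmod (c i x))\<^sup>2)) * indicator D x \<partial>M) = (\<Sum>i. ennreal ((norm (u i))\<^sup>2))"
    unfolding nu ennreal_suminf_multc[symmetric] by (intro nn_integral_suminf) measurable
  also have "\<dots> = ennreal ((norm v)\<^sup>2)"
    using vs by (intro suminf_ennreal_eq) auto
  finally show "(\<integral>\<^sup>+x\<in>D. (\<Sum>i. ennreal ((cmod (c i x))\<^sup>2)) \<partial>M) = (\<integral>\<^sup>+x\<in>D. indicator B x \<partial>M)"
    unfolding nv .
qed

text \<open>The pointwise counterpart of the invariance of Hilbert space dimension: both counts are
  the double sum of the squared moduli of the coefficients between the frames, taken in the two
  orders.\<close>

lemma frame_count_unique:
  assumes k: "frame k A" and l: "frame l B"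
  shows "AE x in M. (\<Sum>i. indicator (A i) x :: ennreal) = (\<Sum>j. indicator (B j) x)"
proof -
  have k': "k i \<in> K" "A i \<in> sets M" "has_density (k i) (k i) (indicator (A i))" for i
    using k by (auto simp: frame_def dest: spec2[of _ i i])
  have l': "l i \<in> K" "B i \<in> sets M" "has_density (l i) (l i) (indicator (B i))" for i
    using l by (auto simp: frame_def dest: spec2[of _ i i])
  from ex_has_density[OF k'(1) l'(1)] obtain c where c: "has_density (k i) (l j) (c i j)" for i j
    by metis
  note b = coefficient_bounds[OF k' l' c]
  \<comment> \<open>Exchanging the roles of the frames conjugates the coefficients, which leaves the
    squared moduli unchanged.\<close>
  have c': "has_density (l j) (k i) (\<lambda>x. cnj (c i j x))" for i j
    unfolding has_density_def
  proof (intro conjI ballI)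
    show "integrable M (\<lambda>x. cnj (c i j x))"
      using has_density_integrable[OF c] by simp
    fix g assume g: "g \<in> Linf M"
    have "cinner (l j) (\<pi> g (k i)) = cnj (cinner (k i) (\<pi> (\<lambda>x. cnj (g x)) (l j)))"
      using g k' l' by (subst cinner_commute) (simp add: cinner_rep_left)
    also have "\<dots> = cnj (LINT x|M. cnj (g x) * c i j x)"
      by (simp only: has_densityD[OF c Linf_cnj[OF g]])
    also have "\<dots> = (LINT x|M. g x * cnj (c i j x))"
      by (subst Bochner_Integration.integral_cnj[symmetric]) (simp only: complex_cnj_mult complex_cnj_cnj)
    finally show "cinner (l j) (\<pi> g (k i)) = (LINT x|M. g x * cnj (c i j x))" .
  qed
  have 1: "AE x in M. \<forall>j. (\<Sum>i. ennreal ((cmod (c i j x))\<^sup>2)) = indicator (B j) x"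
    unfolding AE_all_countable using frame_parseval[OF k l' b(1,2) c] by blast
  have "AE x in M. (\<Sum>j. ennreal ((cmod (cnj (c i j x)))\<^sup>2)) = indicator (A i) x" for i
  proof (rule frame_parseval[OF l k'])
    show "(\<lambda>x. cnj (c i j x)) \<in> Linf M" for j using b(1) by simp
    show "AE x in M. cnj (c i j x) * indicator (B j) x = cnj (c i j x)" for j
      using b(3)[of i j] by eventually_elim (auto split: split_indicator)
  qed (rule c')
  then have 2: "AE x in M. \<forall>i. (\<Sum>j. ennreal ((cmod (c i j x))\<^sup>2)) = indicator (A i) x"
    unfolding AE_all_countable by simp
  \<comment> \<open>Tonelli's theorem for the counting measure; in \<open>ennreal\<close> it covers
    infinite sums as well.\<close>
  have swap: "(\<Sum>i. \<Sum>j. f i j) = (\<Sum>j. \<Sum>i. f i j)" for f :: "nat \<Rightarrow> nat \<Rightarrow> ennreal"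
  proof -
    have "(\<Sum>i. \<Sum>j. f i j) = (\<integral>\<^sup>+i. (\<Sum>j. f i j) \<partial>count_space UNIV)"
      by (simp add: nn_integral_count_space_nat)
    also have "\<dots> = (\<Sum>j. \<integral>\<^sup>+i. f i j \<partial>count_space UNIV)"
      by (rule nn_integral_suminf) simp
    finally show ?thesis by (simp add: nn_integral_count_space_nat)
  qed
  from 1 2 show ?thesis
  proof eventually_elim
    case (elim x)
    show ?case
      using swap[of "\<lambda>i j. ennreal ((cmod (c i j x))\<^sup>2)"] by (simp only: elim(1)[rule_format] elim(2)[rule_format])
  qed
qed

end

section \<open>Multiplicity functions and frames\<close>

lemma L2_measurable: "f \<in> L2 M m \<Longrightarrow> (\<lambda>x. f x n) \<in> borel_measurable M"
  by (simp add: L2_def)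

lemma L2_summable: "f \<in> L2 M m \<Longrightarrow> x \<in> space M \<Longrightarrow> summable (\<lambda>n. (cmod (f x n))\<^sup>2)"
  by (auto simp: L2_def Cdim_def)

lemma mult_le_sum_squares: "(a::real) * b \<le> a\<^sup>2 + b\<^sup>2"
proof -
  have "2 * (a * b) \<le> a\<^sup>2 + b\<^sup>2"
    using sum_squares_bound[of a b] by simp
  moreover have "0 \<le> a\<^sup>2 + b\<^sup>2" by simp
  ultimately show ?thesis by linarith
qed

lemma L2_norm_summable:
  assumes "f \<in> L2 M m" "h \<in> L2 M m" "x \<in> space M"
  shows "summable (\<lambda>n. cmod (cnj (f x n) * h x n))"
proof (rule summable_comparison_test')
  show "summable (\<lambda>n. (cmod (f x n))\<^sup>2 + (cmod (h x n))\<^sup>2)"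
    using assms by (intro summable_add L2_summable)
  show "norm (cmod (cnj (f x n) * h x n)) \<le> (cmod (f x n))\<^sup>2 + (cmod (h x n))\<^sup>2" if "n \<ge> 0" for n
    using mult_le_sum_squares[of "cmod (f x n)" "cmod (h x n)"] by (simp add: norm_mult)
qed

text \<open>The inner product in the fibre \<open>Cdim (m x)\<close>, whose integral is
  \<open>L2_inner\<close>.\<close>

definition L2_density :: "('x \<Rightarrow> nat \<Rightarrow> complex) \<Rightarrow> ('x \<Rightarrow> nat \<Rightarrow> complex) \<Rightarrow> 'x \<Rightarrow> complex" where
  "L2_density f h x = (\<Sum>n. cnj (f x n) * h x n)"

lemma L2_density_measurable:
  assumes "f \<in> L2 M m" "h \<in> L2 M m"
  shows "L2_density f h \<in> borel_measurable M"
  unfolding L2_density_def[abs_def] using assms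
  by (intro borel_measurable_suminf borel_measurable_times borel_measurable_cnj L2_measurable)

lemma L2_norm_square_integrable:
  assumes f: "f \<in> L2 M m" shows "integrable M (\<lambda>x. \<Sum>n. (cmod (f x n))\<^sup>2)"
proof (rule integrableI_nonneg)
  show "(\<lambda>x. \<Sum>n. (cmod (f x n))\<^sup>2) \<in> borel_measurable M"
    using L2_measurable[OF f] by measurable
  show "AE x in M. 0 \<le> (\<Sum>n. (cmod (f x n))\<^sup>2)"
    using L2_summable[OF f] by (intro AE_I2 suminf_nonneg) auto
  show "(\<integral>\<^sup>+x. ennreal (\<Sum>n. (cmod (f x n))\<^sup>2) \<partial>M) < \<infinity>"
    using f by (simp add: L2_def)
qed

lemma L2_density_integrable:
  assumes f: "f \<in> L2 M m" and h: "h \<in> L2 M m"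
  shows "integrable M (L2_density f h)"
proof (rule Bochner_Integration.integrable_bound)
  show "integrable M (\<lambda>x. (\<Sum>n. (cmod (f x n))\<^sup>2) + (\<Sum>n. (cmod (h x n))\<^sup>2))"
    using f h by (intro Bochner_Integration.integrable_add L2_norm_square_integrable)
  show "L2_density f h \<in> borel_measurable M"
    using f h by (rule L2_density_measurable)
  show "AE x in M. norm (L2_density f h x) \<le> norm ((\<Sum>n. (cmod (f x n))\<^sup>2) + (\<Sum>n. (cmod (h x n))\<^sup>2))"
  proof (rule AE_I2)
    fix x assume x: "x \<in> space M"
    note sf = L2_summable[OF f x] and sh = L2_summable[OF h x] and s = L2_norm_summable[OF f h x]
    have "norm (L2_density f h x) \<le> (\<Sum>n. cmod (cnj (f x n) * h x n))"
      unfolding L2_density_def by (rule summable_norm[OF s])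
    also have "\<dots> \<le> (\<Sum>n. (cmod (f x n))\<^sup>2 + (cmod (h x n))\<^sup>2)"
    proof (rule suminf_le[OF _ s summable_add[OF sf sh]])
      show "cmod (cnj (f x n) * h x n) \<le> (cmod (f x n))\<^sup>2 + (cmod (h x n))\<^sup>2" for n
        using mult_le_sum_squares[of "cmod (f x n)" "cmod (h x n)"] by (simp add: norm_mult)
    qed
    also have "\<dots> = (\<Sum>n. (cmod (f x n))\<^sup>2) + (\<Sum>n. (cmod (h x n))\<^sup>2)"
      by (rule suminf_add[OF sf sh, symmetric])
    finally show "norm (L2_density f h x) \<le> norm ((\<Sum>n. (cmod (f x n))\<^sup>2) + (\<Sum>n. (cmod (h x n))\<^sup>2))"
      by simp
  qed
qed

text \<open>\<open>J\<close> turns \<open>\<pi> g\<close> into multiplication by \<open>g\<close>,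
  which comes out of the fibrewise inner product.\<close>

lemma cinner_eq_integral_L2_density:
  assumes J: "unitary_onto_L2 M m K J"
    and mult: "\<forall>g\<in>Linf M. \<forall>k\<in>K. AE x in M. J (\<pi> g k) x = (\<lambda>n. g x * J k x n)"
    and inv: "\<And>g k. g \<in> Linf M \<Longrightarrow> k \<in> K \<Longrightarrow> \<pi> g k \<in> K"
    and k: "k \<in> K" and l: "l \<in> K" and g: "g \<in> Linf M"
  shows "cinner k (\<pi> g l) = (LINT x|M. g x * L2_density (J k) (J l) x)"
proof -
  have J_in: "J k \<in> L2 M m" if "k \<in> K" for k using J that by (simp add: unitary_onto_L2_def)
  have "cinner k (\<pi> g l) = L2_inner M (J k) (J (\<pi> g l))"
    using J k inv[OF g l] by (simp add: unitary_onto_L2_def)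
  also have "\<dots> = (LINT x|M. L2_density (J k) (J (\<pi> g l)) x)"
    by (simp add: L2_inner_def L2_density_def)
  also have "\<dots> = (LINT x|M. g x * L2_density (J k) (J l) x)"
  proof (rule integral_cong_AE)
    show "L2_density (J k) (J (\<pi> g l)) \<in> borel_measurable M"
      by (rule L2_density_measurable[OF J_in[OF k] J_in[OF inv[OF g l]]])
    show "(\<lambda>x. g x * L2_density (J k) (J l) x) \<in> borel_measurable M"
      using g by (intro borel_measurable_times Linf_measurable L2_density_measurable[OF J_in[OF k] J_in[OF l]])
    from mult g l have "AE x in M. J (\<pi> g l) x = (\<lambda>n. g x * J l x n)" by blast
    with AE_space show "AE x in M. L2_density (J k) (J (\<pi> g l)) x = g x * L2_density (J k) (J l) x"
    proof eventually_elim
      case (elim x)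
      have "summable (\<lambda>n. cnj (J k x n) * J l x n)"
        using L2_norm_summable[OF J_in[OF k] J_in[OF l] elim(1)] by (rule summable_norm_cancel)
      from suminf_mult[OF this, of "g x"] show ?case
        by (simp add: L2_density_def elim(2) algebra_simps)
    qed
  qed
  finally show ?thesis .
qed

text \<open>Supplies the density condition of \<open>Linf_module\<close>, with the fibrewise inner
  product of the images under \<open>J\<close> as density.\<close>

lemma multiplicity_function_density:
  assumes mf: "is_multiplicity_function M \<pi> K m" and star: "star_representation M \<pi> K"
    and k: "k \<in> K" and l: "l \<in> K"
  shows "\<exists>d. integrable M d \<and> (\<forall>g\<in>Linf M. cinner k (\<pi> g l) = (LINT x|M. g x * d x))"
proof -
  from mf obtain J where J: "unitary_onto_L2 M m K J"
    and mult: "\<forall>g\<in>Linf M. \<forall>k\<in>K. AE x in M. J (\<pi> g k) x = (\<lambda>n. g x * J k x n)"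
    unfolding is_multiplicity_function_def by blast
  have "\<pi> g k \<in> K" if "g \<in> Linf M" "k \<in> K" for g k
    using star that unfolding star_representation_def Linf_representation_def bounded_operators_def by blast
  note d = cinner_eq_integral_L2_density[OF J mult this k l]
  have "integrable M (L2_density (J k) (J l))"
    using J k l by (intro L2_density_integrable) (auto simp: unitary_onto_L2_def)
  with d show ?thesis by blast
qed

text \<open>Recovers a multiplicity as the number of sets \<open>{x. enat n < m x}\<close>
  containing the point; \<open>ennreal\<close> accommodates the value
  \<open>\<infinity>\<close>.\<close>

lemma suminf_indicator_less_enat: "(\<Sum>n. if enat n < d then 1 else 0 :: ennreal) = ennreal_of_enat d"
proof (cases d)
  case (enat c)
  have "(\<Sum>n. if enat n < d then 1 else 0 :: ennreal) = (\<Sum>n<c. if enat n < d then 1 else 0)"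
    by (rule suminf_finite) (auto simp: enat)
  then show ?thesis by (simp add: enat)
next
  case infinity
  have "(\<Sum>n. 1 :: ennreal) = \<infinity>"
    using nn_integral_count_space_nat[of "\<lambda>_. 1"] by simp
  then show ?thesis by (simp add: infinity)
qed

context Linf_module
begin

lemma has_density_cong_AE:
  assumes d: "has_density k l d" and e: "e \<in> borel_measurable M" and eq: "AE x in M. d x = e x"
  shows "has_density k l e"
  unfolding has_density_def
proof (intro conjI ballI)
  have [measurable]: "d \<in> borel_measurable M" using has_density_integrable[OF d] by simp
  show "integrable M e"
    using has_density_integrable[OF d] integrable_cong_AE[of d M e] e eq by simp
  fix g assume g: "g \<in> Linf M"
  have [measurable]: "g \<in> borel_measurable M" using g by (rule Linf_measurable)
  have "(LINT x|M. g x * d x) = (LINT x|M. g x * e x)"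
    using eq e by (intro integral_cong_AE) (auto elim!: eventually_mono)
  then show "cinner k (\<pi> g l) = (LINT x|M. g x * e x)"
    using has_densityD[OF d g] by simp
qed

lemma AE_eq_zero_if_orthogonal:
  assumes d: "has_density k v d" and k: "k \<in> K" and v: "v \<in> K"
    and 0: "\<And>g. g \<in> Linf M \<Longrightarrow> cinner (\<pi> g k) v = 0"
  shows "AE x in M. d x = 0"
proof (rule AE_eq_zero_if_orthogonal_bounded)
  show "integrable M d" using d by (rule has_density_integrable)
  fix g :: "'x \<Rightarrow> complex" assume "g \<in> borel_measurable M" "\<And>x. cmod (g x) \<le> 1"
  then have g: "g \<in> Linf M" by (rule Linf_intro)
  show "(LINT x|M. g x * d x) = 0"
    using 0[OF Linf_cnj[OF g]] cinner_rep_left[OF Linf_cnj[OF g] k v] has_densityD[OF d g] by simp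
qed

text \<open>The frame consists of the preimages under \<open>J\<close> of the coordinate sections; a
  vector orthogonal to the submodules they generate has all coordinates zero.\<close>

lemma multiplicity_function_frame:
  assumes mf: "is_multiplicity_function M \<pi> K m"
  shows "\<exists>k. frame k (\<lambda>n. {x\<in>space M. enat n < m x})"
proof -
  from mf obtain J where J: "unitary_onto_L2 M m K J"
    and mult: "\<forall>g\<in>Linf M. \<forall>k\<in>K. AE x in M. J (\<pi> g k) x = (\<lambda>n. g x * J k x n)"
    unfolding is_multiplicity_function_def by blast
  from mf have m[measurable]: "m \<in> measurable M (count_space UNIV)"
    by (simp add: is_multiplicity_function_def)
  let ?A = "\<lambda>n. {x\<in>space M. enat n < m x}"
  have A[measurable]: "?A n \<in> sets M" for n by measurable
  \<comment> \<open>The \<open>n\<close>-th unit vector, cut off to 0 where \<open>m x\<close> is at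
    most \<open>n\<close> so that it stays in \<open>Cdim (m x)\<close>.\<close>
  define e where "e n x p = (if p = n \<and> enat n < m x then 1 else 0 :: complex)" for n x p
  have e_sums: "(\<lambda>p. f p * e n x p) sums (if enat n < m x then f n else 0)" for f n x
  proof -
    have "(\<lambda>p. f p * e n x p) = (\<lambda>p. if p = n then (if enat n < m x then f p else 0) else 0)"
      by (auto simp: e_def fun_eq_iff)
    then show ?thesis
      using sums_single[of n "\<lambda>p. if enat n < m x then f p else 0"] by (simp only:)
  qed
  have J_in: "J k \<in> L2 M m" if "k \<in> K" for k using J that by (simp add: unitary_onto_L2_def)
  have "e n \<in> L2 M m" for n
  proof -
    have sq: "(\<lambda>p. (cmod (e n x p))\<^sup>2) sums (if enat n < m x then 1 else 0)" for x
    proof -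
      have "(\<lambda>p. (cmod (e n x p))\<^sup>2) = (\<lambda>p. if p = n then (if enat n < m x then 1 else 0) else 0)"
        by (auto simp: e_def fun_eq_iff)
      then show ?thesis
        using sums_single[of n "\<lambda>p. if enat n < m x then 1 else 0 :: real"] by (simp only:)
    qed
    have "(\<integral>\<^sup>+x. ennreal (\<Sum>p. (cmod (e n x p))\<^sup>2) \<partial>M) \<le> (\<integral>\<^sup>+x. 1 \<partial>M)"
      by (intro nn_integral_mono) (simp add: sums_unique[OF sq, symmetric])
    also have "\<dots> < \<infinity>" by (simp add: emeasure_space_1)
    finally have "(\<integral>\<^sup>+x. ennreal (\<Sum>p. (cmod (e n x p))\<^sup>2) \<partial>M) < \<infinity>" .
    moreover have "(\<lambda>x. e n x p) \<in> borel_measurable M" for p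
      unfolding e_def by measurable
    moreover have "e n x \<in> Cdim (m x)" for x
      using sums_summable[OF sq] by (auto simp: Cdim_def e_def)
    ultimately show ?thesis by (simp add: L2_def)
  qed
  with J have "\<forall>n. \<exists>k\<in>K. AE x in M. J k x = e n x" by (simp add: unitary_onto_L2_def)
  then obtain k where k: "\<And>n. k n \<in> K" and Jk: "\<And>n. AE x in M. J (k n) x = e n x" by metis
  have dens: "has_density v w (L2_density (J v) (J w))" if "v \<in> K" "w \<in> K" for v w
    unfolding has_density_def
    using L2_density_integrable[OF J_in J_in] cinner_eq_integral_L2_density[OF J mult rep_in] that by blast
  have "frame k ?A"
    unfolding frame_def
  proof (intro conjI allI ballI impI)
    show "k i \<in> K" "?A i \<in> sets M" for i by (rule k, rule A)
    show "has_density (k i) (k j) (if i = j then indicator (?A i) else (\<lambda>x. 0))" for i j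
    proof (rule has_density_cong_AE[OF dens[OF k k]])
      show "(if i = j then indicator (?A i) else (\<lambda>x. 0)) \<in> borel_measurable M" by simp
      from Jk[of i] Jk[of j] AE_space[of M]
      show "AE x in M. L2_density (J (k i)) (J (k j)) x = (if i = j then indicator (?A i) else (\<lambda>x. 0)) x"
      proof eventually_elim
        case (elim x)
        have "L2_density (J (k i)) (J (k j)) x = (if enat j < m x then cnj (e i x j) else 0)"
          unfolding L2_density_def elim(1,2) using sums_unique[OF e_sums[of "\<lambda>p. cnj (e i x p)" j x]] by simp
        with elim(3) show ?case by (auto simp: e_def)
      qed
    qed
    fix v assume v: "v \<in> K" and orth: "\<forall>i. \<forall>g\<in>Linf M. cinner (\<pi> g (k i)) v = 0"
    have "AE x in M. J v x i = 0" for i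
    proof -
      have "AE x in M. L2_density (J (k i)) (J v) x = 0"
        using AE_eq_zero_if_orthogonal[OF dens[OF k v] k v] orth by blast
      with Jk[of i] AE_space[of M] show ?thesis
      proof eventually_elim
        case (elim x)
        have "L2_density (J (k i)) (J v) x = (if enat i < m x then J v x i else 0)"
        proof -
          have "cnj (e i x p) = e i x p" for p by (simp add: e_def)
          then show ?thesis
            unfolding L2_density_def elim(1) using sums_unique[OF e_sums[of "\<lambda>p. J v x p" i x]]
            by (simp add: mult.commute)
        qed
        \<comment> \<open>The truncated unit vectors do not see the coordinates from index
          \<open>m x\<close> on; those vanish by membership in \<open>Cdim (m x)\<close>.\<close>
        moreover have "J v x i = 0" if "\<not> enat i < m x"
          using J_in[OF v] elim(2) that by (auto simp: L2_def Cdim_def not_less)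
        ultimately show ?case using elim(3) by (auto split: if_splits)
      qed
    qed
    then have "AE x in M. \<forall>i. J v x i = 0" by (simp add: AE_all_countable)
    then have "AE x in M. L2_density (J v) (J v) x = 0"
      by eventually_elim (simp add: L2_density_def)
    then have "(LINT x|M. L2_density (J v) (J v) x) = 0"
      by (rule integral_eq_zero_AE)
    moreover have "cinner v v = L2_inner M (J v) (J v)"
      using J v by (simp add: unitary_onto_L2_def)
    ultimately have "cinner v v = 0"
      by (simp add: L2_inner_def L2_density_def)
    then show "v = 0" by (simp add: cinner_self)
  qed
  then show ?thesis by blast
qed

end

section \<open>Strongly invariant endomorphisms\<close>

locale strongly_invariant_endomorphism = prob_space M for M :: "'x measure" +
  fixes r :: "'x \<Rightarrow> 'x"
  assumes r_measurable [measurable]: "r \<in> measurable M M"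
    and finite_fibre: "\<And>x. x \<in> space M \<Longrightarrow> finite (fibre M r x)"
    and r_onto: "r ` space M = space M"
    and invariant: "strongly_invariant M r"
begin

abbreviation "fib \<equiv> fibre M r"

text \<open>The normalised transfer operator of \<open>r\<close>; a factor of the form
  \<open>g \<circ> r\<close> comes out of it as \<open>g\<close>.\<close>

definition fibre_mean :: "('x \<Rightarrow> complex) \<Rightarrow> 'x \<Rightarrow> complex" where
  "fibre_mean f x = (\<Sum>y\<in>fib x. f y) / of_nat (card (fib x))"

lemma fibre_mean_measurable: "f \<in> Linf M \<Longrightarrow> fibre_mean f \<in> borel_measurable M"
  using invariant by (simp add: strongly_invariant_def fibre_mean_def[abs_def])

lemma integral_fibre_mean: "f \<in> Linf M \<Longrightarrow> (LINT x|M. f x) = (LINT x|M. fibre_mean f x)"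
  using invariant by (simp add: strongly_invariant_def fibre_mean_def[abs_def])

lemma r_space: "x \<in> space M \<Longrightarrow> r x \<in> space M"
  using r_measurable by (rule measurable_space)

lemma fibre_self: "y \<in> space M \<Longrightarrow> y \<in> fib (r y)"
  by (simp add: fibre_def)

lemma card_fibre_pos: assumes x: "x \<in> space M" shows "0 < card (fib x)"
proof -
  from x r_onto obtain y where "y \<in> space M" "r y = x" by (metis imageE)
  then have "y \<in> fib x" by (simp add: fibre_def)
  with finite_fibre[OF x] show ?thesis by (auto simp: card_gt_0_iff)
qed

section \<open>Invariance of the measure under \<open>r\<close>\<close>

lemma integral_indicator_complex:
  assumes "A \<in> sets M" shows "(LINT x|M. indicator A x) = complex_of_real (prob A)"
proof -
  have "(LINT x|M. indicator A x) = (LINT x|M. complex_of_real (indicator A x))"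
    by (intro Bochner_Integration.integral_cong refl) (simp split: split_indicator)
  also have "\<dots> = complex_of_real (prob A)"
    unfolding integral_complex_of_real using assms by simp
  finally show ?thesis .
qed

text \<open>The preimage of \<open>A\<close> contains all or nothing of each fibre, so the fibre
  mean of its indicator is the indicator of \<open>A\<close>; fibres are nonempty because
  \<open>r\<close> is onto.\<close>

lemma prob_vimage: assumes A: "A \<in> sets M" shows "prob (r -` A \<inter> space M) = prob A"
proof -
  have rA: "r -` A \<inter> space M \<in> sets M" using A by measurable
  have "complex_of_real (prob (r -` A \<inter> space M)) = (LINT x|M. indicator (r -` A \<inter> space M) x)"
    using integral_indicator_complex[OF rA] by (rule sym)
  also have "\<dots> = (LINT x|M. fibre_mean (indicator (r -` A \<inter> space M)) x)"
    using rA by (intro integral_fibre_mean Linf_indicator)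
  also have "\<dots> = (LINT x|M. indicator A x)"
  proof (rule Bochner_Integration.integral_cong[OF refl])
    fix x assume x: "x \<in> space M"
    have "(\<Sum>y\<in>fib x. indicator (r -` A \<inter> space M) y :: complex) = (\<Sum>y\<in>fib x. indicator A x)"
      by (intro sum.cong) (auto simp: fibre_def split: split_indicator)
    then show "fibre_mean (indicator (r -` A \<inter> space M)) x = indicator A x"
      using card_fibre_pos[OF x] by (simp add: fibre_mean_def)
  qed
  also have "\<dots> = complex_of_real (prob A)"
    using A by (rule integral_indicator_complex)
  finally show ?thesis by (simp only: of_real_eq_iff)
qed

lemma distr_r: "distr M M r = M"
  by (rule measure_eqI) (simp_all add: emeasure_distr emeasure_eq_measure prob_vimage)

lemma Linf_ball_comp: "g \<in> Linf_ball M C \<Longrightarrow> g \<circ> r \<in> Linf_ball M C"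
proof -
  assume g: "g \<in> Linf_ball M C"
  then have "AE x in distr M M r. cmod (g x) \<le> C"
    unfolding distr_r by (simp add: Linf_ball_def)
  then have "AE x in M. cmod (g (r x)) \<le> C"
    by (rule AE_distrD[OF r_measurable])
  with g show ?thesis
    by (simp add: Linf_ball_def measurable_comp[OF r_measurable])
qed

lemma Linf_iff_Linf_ball: "g \<in> Linf M \<longleftrightarrow> (\<exists>C. g \<in> Linf_ball M C)"
  by (auto simp: Linf_def Linf_ball_def)

lemma Linf_comp [simp]: "g \<in> Linf M \<Longrightarrow> g \<circ> r \<in> Linf M"
  using Linf_ball_comp unfolding Linf_iff_Linf_ball by blast

lemma Linf_comp' [simp]: "g \<in> Linf M \<Longrightarrow> (\<lambda>x. g (r x)) \<in> Linf M"
  using Linf_comp by (simp add: comp_def)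

text \<open>\<open>h'\<close> is the Radon-Nikodym derivative of the image under \<open>r\<close> of
  the measure with density \<open>h\<close>. This image is absolutely continuous because
  \<open>r\<close> preserves the measure.\<close>

lemma transfer_nonneg:
  fixes h :: "'x \<Rightarrow> real"
  assumes h: "integrable M h" and pos: "\<And>x. 0 \<le> h x"
  shows "\<exists>h'. integrable M h' \<and> (\<forall>g\<in>Linf M. (LINT x|M. g (r x) * of_real (h x)) = (LINT x|M. g x * of_real (h' x :: real)))"
proof -
  have [measurable]: "h \<in> borel_measurable M" using h by simp
  let ?N = "distr (density M h) M r"
  have r': "r \<in> measurable (density M h) M" by simp
  have "absolutely_continuous M ?N"
    unfolding absolutely_continuous_def
  proof
    fix A assume A: "A \<in> null_sets M"
    then have [measurable]: "A \<in> sets M" by auto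
    have "emeasure M (r -` A \<inter> space M) = 0"
      using A prob_vimage[of A] by (simp add: emeasure_eq_measure null_sets_def)
    then have "AE x in M. x \<notin> r -` A \<inter> space M"
      by (intro AE_not_in) (auto simp: null_sets_def)
    then have "(\<integral>\<^sup>+x. ennreal (h x) * indicator (r -` A \<inter> space M) x \<partial>M) = (\<integral>\<^sup>+x. 0 \<partial>M)"
      by (intro nn_integral_cong_AE) (auto elim!: eventually_mono)
    then have "emeasure ?N A = 0"
      by (simp add: emeasure_distr emeasure_density)
    then show "A \<in> null_sets ?N" by (simp add: null_sets_def)
  qed
  from Radon_Nikodym[OF this] obtain f where f[measurable]: "f \<in> borel_measurable M" and N: "density M f = ?N"
    by auto
  have "(\<integral>\<^sup>+x. f x \<partial>M) = emeasure (density M f) (space M)"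
    by (simp add: emeasure_density cong: nn_integral_cong)
  also have "\<dots> = (\<integral>\<^sup>+x. ennreal (h x) \<partial>M)"
  proof -
    have "r -` space M \<inter> space M = space M" using r_space by auto
    then show ?thesis
      unfolding N by (simp add: emeasure_distr emeasure_density cong: nn_integral_cong)
  qed
  also have "\<dots> < \<infinity>"
    using h pos by (simp add: nn_integral_eq_integral)
  finally have fin: "(\<integral>\<^sup>+x. f x \<partial>M) < \<infinity>" .
  \<comment> \<open>The derivative has the finite mass of \<open>h\<close>, hence is finite almost
    everywhere and may be replaced by a real-valued function.\<close>
  then have ae: "AE x in M. f x = ennreal (enn2real (f x))"
    using nn_integral_PInf_AE[OF f] by (auto elim!: eventually_mono simp: less_top)
  have int: "integrable M (\<lambda>x. enn2real (f x))"
  proof (rule integrableI_nonneg)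
    have "(\<integral>\<^sup>+x. ennreal (enn2real (f x)) \<partial>M) = (\<integral>\<^sup>+x. f x \<partial>M)"
      using ae by (intro nn_integral_cong_AE) (auto elim!: eventually_mono)
    with fin show "(\<integral>\<^sup>+x. ennreal (enn2real (f x)) \<partial>M) < \<infinity>" by simp
  qed auto
  have d: "density M (\<lambda>x. ennreal (enn2real (f x))) = ?N"
    unfolding N[symmetric] using ae by (intro density_cong) (auto elim!: eventually_mono)
  have "(LINT x|M. g (r x) * of_real (h x)) = (LINT x|M. g x * of_real (enn2real (f x)))" if "g \<in> Linf M" for g
  proof -
    have g[measurable]: "g \<in> borel_measurable M" using that by (rule Linf_measurable)
    have "(LINT x|M. h x *\<^sub>R g (r x)) = (LINT x|density M h. g (r x))"
      using pos by (intro integral_density[symmetric]) auto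
    also have "\<dots> = (LINT x|?N. g x)"
      by (rule integral_distr[symmetric]) auto
    also have "\<dots> = (LINT x|M. enn2real (f x) *\<^sub>R g x)"
      unfolding d[symmetric] by (intro integral_density) auto
    finally show ?thesis by (simp add: scaleR_conv_of_real mult.commute)
  qed
  with int show ?thesis by blast
qed

text \<open>Composition with \<open>r\<close> has a preadjoint on integrable functions, obtained
  from the nonnegative case by splitting into real and imaginary, positive and negative parts. It
  makes composition weak-* continuous and yields densities on \<open>V 1\<close>.\<close>

lemma transfer:
  assumes h: "integrable M h"
  shows "\<exists>h'. integrable M h' \<and> (\<forall>g\<in>Linf M. (LINT x|M. g (r x) * h x) = (LINT x|M. g x * h' x :: complex))"
proof -
  have real: "\<exists>h'. integrable M h' \<and>
      (\<forall>g\<in>Linf M. (LINT x|M. g (r x) * of_real (h x)) = (LINT x|M. g x * of_real (h' x :: real)))"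
    if h: "integrable M h" for h :: "'x \<Rightarrow> real"
  proof -
    have p: "integrable M (\<lambda>x. max 0 (h x))" and n: "integrable M (\<lambda>x. max 0 (- h x))"
      using h by auto
    obtain p' where p': "integrable M p'"
      "\<And>g. g \<in> Linf M \<Longrightarrow> (LINT x|M. g (r x) * of_real (max 0 (h x))) = (LINT x|M. g x * of_real (p' x :: real))"
      using transfer_nonneg[OF p] by auto
    obtain n' where n': "integrable M n'"
      "\<And>g. g \<in> Linf M \<Longrightarrow> (LINT x|M. g (r x) * of_real (max 0 (- h x))) = (LINT x|M. g x * of_real (n' x :: real))"
      using transfer_nonneg[OF n] by auto
    have "(LINT x|M. g (r x) * of_real (h x)) = (LINT x|M. g x * of_real (p' x - n' x))"
      if g: "g \<in> Linf M" for g
    proof -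
      have "(LINT x|M. g (r x) * of_real (h x)) =
          (LINT x|M. g (r x) * of_real (max 0 (h x)) - g (r x) * of_real (max 0 (- h x)))"
        by (intro Bochner_Integration.integral_cong refl) (auto simp: max_def)
      also have "\<dots> = (LINT x|M. g (r x) * of_real (max 0 (h x))) - (LINT x|M. g (r x) * of_real (max 0 (- h x)))"
        using g p n by (intro Bochner_Integration.integral_diff integrable_Linf_mult integrable_of_real Linf_comp')
      also have "\<dots> = (LINT x|M. g x * of_real (p' x)) - (LINT x|M. g x * of_real (n' x))"
        using g by (simp only: p' n')
      also have "\<dots> = (LINT x|M. g x * of_real (p' x) - g x * of_real (n' x))"
        using g p' n' by (intro Bochner_Integration.integral_diff[symmetric] integrable_Linf_mult integrable_of_real)
      finally show ?thesis by (simp add: right_diff_distrib)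
    qed
    with p' n' show ?thesis by (intro exI[of _ "\<lambda>x. p' x - n' x"]) auto
  qed
  have re: "integrable M (\<lambda>x. Re (h x))" and im: "integrable M (\<lambda>x. Im (h x))" using h by auto
  obtain a where a: "integrable M a"
    "\<And>g. g \<in> Linf M \<Longrightarrow> (LINT x|M. g (r x) * of_real (Re (h x))) = (LINT x|M. g x * of_real (a x :: real))"
    using real[OF re] by auto
  obtain b where b: "integrable M b"
    "\<And>g. g \<in> Linf M \<Longrightarrow> (LINT x|M. g (r x) * of_real (Im (h x))) = (LINT x|M. g x * of_real (b x :: real))"
    using real[OF im] by auto
  have "(LINT x|M. g (r x) * h x) = (LINT x|M. g x * (of_real (a x) + \<i> * of_real (b x)))"
    if g: "g \<in> Linf M" for g
  proof -
    have "(LINT x|M. g (r x) * h x) =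
        (LINT x|M. g (r x) * of_real (Re (h x)) + \<i> * (g (r x) * of_real (Im (h x))))"
      by (intro Bochner_Integration.integral_cong refl) (subst complex_eq, simp add: algebra_simps)
    also have "\<dots> = (LINT x|M. g (r x) * of_real (Re (h x))) + \<i> * (LINT x|M. g (r x) * of_real (Im (h x)))"
    proof -
      have "integrable M (\<lambda>x. g (r x) * of_real (Re (h x)))" "integrable M (\<lambda>x. \<i> * (g (r x) * of_real (Im (h x))))"
        using g re im
        by (auto intro!: integrable_mult_right integrable_Linf_mult integrable_of_real Linf_comp' simp del: of_real_Re)
      then show ?thesis
        by (simp only: Bochner_Integration.integral_add integral_mult_right_zero)
    qed
    also have "\<dots> = (LINT x|M. g x * of_real (a x)) + \<i> * (LINT x|M. g x * of_real (b x))"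
      using g by (simp only: a b)
    also have "\<dots> = (LINT x|M. g x * of_real (a x) + \<i> * (g x * of_real (b x)))"
    proof -
      have "integrable M (\<lambda>x. g x * of_real (a x))" "integrable M (\<lambda>x. \<i> * (g x * of_real (b x)))"
        using g a b by (auto intro!: integrable_mult_right integrable_Linf_mult integrable_of_real)
      then show ?thesis
        by (simp only: Bochner_Integration.integral_add integral_mult_right_zero)
    qed
    finally show ?thesis by (simp add: algebra_simps)
  qed
  with a b show ?thesis by (intro exI[of _ "\<lambda>x. of_real (a x) + \<i> * of_real (b x)"]) auto
qed

text \<open>Strong invariance gives measurability of fibre means, and this ratio is the fibre mean
  of \<open>indicator A\<close>. The cardinality of the fibres is read off from such ratios
  later.\<close>

lemma measurable_card_ratio:
  assumes "A \<in> sets M"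
  shows "(\<lambda>x. real (card (A \<inter> fib x)) / real (card (fib x))) \<in> borel_measurable M"
proof -
  have "(\<lambda>x. Re (fibre_mean (indicator A) x)) \<in> borel_measurable M"
    using fibre_mean_measurable[OF Linf_indicator[OF assms]] by measurable
  moreover have "Re (fibre_mean (indicator A) x) = real (card (A \<inter> fib x)) / real (card (fib x))" if "x \<in> space M" for x
  proof -
    have "(\<Sum>y\<in>fib x. indicator A y :: complex) = of_nat (card (A \<inter> fib x))"
    proof -
      have "(\<Sum>y\<in>fib x. indicator A y :: complex) = (\<Sum>y\<in>fib x \<inter> A. 1)"
        unfolding sum.inter_restrict[OF finite_fibre[OF that]] 
        by (intro sum.cong refl) (simp split: split_indicator)
      then show ?thesis by (simp add: Int_commute)
    qed
    then have "fibre_mean (indicator A) x = of_real (real (card (A \<inter> fib x)) / real (card (fib x)))"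
      by (simp add: fibre_mean_def)
    then show ?thesis by (simp only: Re_complex_of_real)
  qed
  ultimately show ?thesis by (subst measurable_cong[symmetric]) auto
qed

text \<open>To isolate \<open>y\<close> in \<open>F\<close>, choose for each other point of
  \<open>F\<close> a separating set or complement that contains \<open>y\<close> but not that point,
  and intersect. There are only countably many such finite intersections.\<close>

lemma countable_isolating_family:
  assumes "countably_separated M"
  obtains B :: "nat \<Rightarrow> 'x set" where "\<And>j. B j \<in> sets M"
    "\<And>F y. finite F \<Longrightarrow> F \<subseteq> space M \<Longrightarrow> y \<in> F \<Longrightarrow> \<exists>j. B j \<inter> F = {y}"
proof -
  from assms obtain \<A> where \<A>: "countable \<A>" "\<A> \<subseteq> sets M"
    and sep: "\<forall>x\<in>space M. \<forall>y\<in>space M. x \<noteq> y \<longrightarrow> (\<exists>A\<in>\<A>. (x \<in> A) \<noteq> (y \<in> A))"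
    unfolding countably_separated_def by (elim exE conjE)
  define \<C> where "\<C> = \<A> \<union> (\<lambda>A. space M - A) ` \<A>"
  have \<C>: "countable \<C>" "\<C> \<subseteq> sets M" using \<A> by (auto simp: \<C>_def)
  define \<B> where "\<B> = (\<lambda>F. space M \<inter> \<Inter>F) ` {F. finite F \<and> F \<subseteq> \<C>}"
  have cB: "countable \<B>"
    unfolding \<B>_def using \<C>(1) by (intro countable_image countable_Collect_finite_subset)
  have ne: "\<B> \<noteq> {}" unfolding \<B>_def by blast
  have sB: "\<B> \<subseteq> sets M"
  proof
    fix B assume "B \<in> \<B>"
    then obtain F where F: "finite F" "F \<subseteq> \<C>" "B = space M \<inter> \<Inter>F" by (auto simp: \<B>_def)
    from F(1,2) have "space M \<inter> \<Inter>F \<in> sets M"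
    proof (induction F)
      case (insert A F)
      then have "A \<in> sets M" "space M \<inter> \<Inter>F \<in> sets M" using \<C>(2) by auto
      then have "A \<inter> (space M \<inter> \<Inter>F) \<in> sets M" by (rule sets.Int)
      then show ?case by (simp add: Int_ac)
    qed simp
    with F show "B \<in> sets M" by simp
  qed
  show thesis
  proof (rule that[of "from_nat_into \<B>"])
    show "from_nat_into \<B> j \<in> sets M" for j
      using from_nat_into[OF ne, of j] sB by blast
    fix F y assume F: "finite F" "F \<subseteq> space M" "y \<in> F"
    have "\<exists>A\<in>\<C>. y \<in> A \<and> z \<notin> A" if "z \<in> F - {y}" for z
    proof -
      from that F sep obtain A where A: "A \<in> \<A>" "(y \<in> A) \<noteq> (z \<in> A)" by (metis DiffE insertCI subsetD)
      show ?thesis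
      proof (cases "y \<in> A")
        case True then show ?thesis using A by (auto simp: \<C>_def)
      next
        case False then show ?thesis using A F by (intro bexI[of _ "space M - A"]) (auto simp: \<C>_def)
      qed
    qed
    then obtain c where c: "\<And>z. z \<in> F - {y} \<Longrightarrow> c z \<in> \<C> \<and> y \<in> c z \<and> z \<notin> c z" by metis
    let ?B = "space M \<inter> \<Inter>(c ` (F - {y}))"
    have "?B \<in> \<B>" unfolding \<B>_def using F c by blast
    moreover have "?B \<inter> F = {y}" using F c by auto
    ultimately show "\<exists>j. from_nat_into \<B> j \<inter> F = {y}"
      using from_nat_into_surj[OF cB] by metis
  qed
qed

text \<open>A piece collects the points that a fixed \<open>B j\<close> isolates in their fibres and
  whose fibres have a fixed cardinality. Countably many such pieces cover the space, and removing
  earlier pieces makes them disjoint.\<close>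

lemma measurable_fibre_partition:
  assumes "countably_separated M"
  obtains E :: "nat \<Rightarrow> 'x set" and c :: "nat \<Rightarrow> nat" where
    "\<And>i. E i \<in> sets M" "disjoint_family E" "(\<Union>i. E i) = space M"
    "\<And>i y. y \<in> E i \<Longrightarrow> E i \<inter> fib (r y) = {y}" "\<And>i y. y \<in> E i \<Longrightarrow> card (fib (r y)) = c i"
proof -
  obtain B :: "nat \<Rightarrow> 'x set" where B[measurable]: "\<And>j. B j \<in> sets M"
    and iso: "\<And>F y. finite F \<Longrightarrow> F \<subseteq> space M \<Longrightarrow> y \<in> F \<Longrightarrow> \<exists>j. B j \<inter> F = {y}"
    using countable_isolating_family[OF assms] by blast
  define a where "a j x = real (card (B j \<inter> fib x)) / real (card (fib x))" for j x
  have a[measurable]: "a j \<in> borel_measurable M" for j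
    unfolding a_def using measurable_card_ratio[OF B] .
  have iso': "\<exists>j. B j \<inter> fib x = {y}" if "x \<in> space M" "y \<in> fib x" for x y
    using finite_fibre[OF that(1)] that(2) by (intro iso) (auto simp: fibre_def)
  \<comment> \<open>The ratios are multiples of the reciprocal of the cardinality, and isolating
    sets attain that reciprocal. The cardinality is thus the inverse of the least nonzero ratio, a
    countable and hence measurable condition.\<close>
  have card_eq: "card (fib x) = n \<longleftrightarrow> (\<exists>j. a j x = 1 / real n) \<and> (\<forall>j. a j x = 0 \<or> 1 / real n \<le> a j x)"
    if x: "x \<in> space M" and n: "n > 0" for x n
  proof -
    note pos = card_fibre_pos[OF x]
    have min: "a j x = 0 \<or> 1 / real (card (fib x)) \<le> a j x" for j
    proof (cases "card (B j \<inter> fib x) = 0")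
      case False
      then have "1 \<le> real (card (B j \<inter> fib x))" by linarith
      then show ?thesis unfolding a_def using pos by (intro disjI2 divide_right_mono) auto
    qed (simp add: a_def)
    obtain y where "y \<in> fib x" using pos by fastforce
    from iso'[OF x this] obtain j where "B j \<inter> fib x = {y}" by blast
    then have j: "a j x = 1 / real (card (fib x))" by (simp add: a_def)
    show ?thesis
    proof
      assume "card (fib x) = n"
      with min j show "(\<exists>j. a j x = 1 / real n) \<and> (\<forall>j. a j x = 0 \<or> 1 / real n \<le> a j x)" by blast
    next
      assume *: "(\<exists>j. a j x = 1 / real n) \<and> (\<forall>j. a j x = 0 \<or> 1 / real n \<le> a j x)"
      then obtain i where "a i x = 1 / real n" by blast
      with min[of i] n have "1 / real (card (fib x)) \<le> 1 / real n" by auto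
      moreover have "1 / real n \<le> 1 / real (card (fib x))"
        using * j pos by (metis divide_eq_0_iff of_nat_0_eq_iff one_neq_zero neq0_conv)
      ultimately have "1 / real (card (fib x)) = 1 / real n" by linarith
      then show "card (fib x) = n" by simp
    qed
  qed
  \<comment> \<open>With \<open>n\<close> the fibre cardinality, a ratio of
    \<open>1 / real n\<close> says that \<open>B j\<close> meets the fibre through \<open>y\<close>
    in one point, which is \<open>y\<close> itself.\<close>
  define D where "D i = (let (j, n) = prod_decode i in
      {y\<in>space M. y \<in> B j \<and> card (fib (r y)) = n \<and> 0 < n \<and> a j (r y) = 1 / real n})" for i
  have D_sets: "D i \<in> sets M" for i
  proof -
    obtain j n where jn: "prod_decode i = (j, n)" by (rule prod.exhaust)
    have "{x\<in>space M. 0 < n \<and> card (fib x) = n} =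
        {x\<in>space M. 0 < n \<and> (\<exists>j. a j x = 1 / real n) \<and> (\<forall>j. a j x = 0 \<or> 1 / real n \<le> a j x)}"
      by (intro Collect_cong conj_cong refl card_eq)
    also have "\<dots> \<in> sets M" by measurable
    finally have "r -` {x\<in>space M. 0 < n \<and> card (fib x) = n} \<inter> space M \<in> sets M"
      by (rule measurable_sets[OF r_measurable])
    moreover have "{y\<in>space M. a j (r y) = 1 / real n} \<in> sets M" by measurable
    ultimately have "B j \<inter> (r -` {x\<in>space M. 0 < n \<and> card (fib x) = n} \<inter> space M) \<inter>
        {y\<in>space M. a j (r y) = 1 / real n} \<in> sets M" (is "?R \<in> _")
      by (rule sets.Int[OF sets.Int[OF B]])
    moreover have "D i = ?R"
      unfolding D_def jn Let_def prod.case using r_space by blast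
    ultimately show ?thesis by (simp only:)
  qed
  have D1: "D i \<inter> fib (r y) = {y}" "card (fib (r y)) = snd (prod_decode i)" if "y \<in> D i" for i y
  proof -
    obtain j n where jn: "prod_decode i = (j, n)" by (rule prod.exhaust)
    from that have y: "y \<in> space M" "y \<in> B j" "card (fib (r y)) = n" "0 < n" "a j (r y) = 1 / real n"
      unfolding D_def jn Let_def prod.case mem_Collect_eq by blast+
    have "card (B j \<inter> fib (r y)) = 1" using y(4,5) unfolding a_def y(3) by simp
    moreover have "y \<in> B j \<inter> fib (r y)" using y fibre_self by simp
    ultimately have "B j \<inter> fib (r y) = {y}" by (metis card_1_singletonE singletonD)
    moreover have "D i \<subseteq> B j" unfolding D_def jn Let_def prod.case by blast
    ultimately show "D i \<inter> fib (r y) = {y}" using that fibre_self[OF y(1)] by blast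
    show "card (fib (r y)) = snd (prod_decode i)" using y jn by simp
  qed
  have "y \<in> (\<Union>i. D i)" if y: "y \<in> space M" for y
  proof -
    obtain j where j: "B j \<inter> fib (r y) = {y}" using iso'[OF r_space[OF y] fibre_self[OF y]] by blast
    have "y \<in> D (prod_encode (j, card (fib (r y))))"
      using y j card_fibre_pos[OF r_space[OF y]] unfolding D_def prod_encode_inverse Let_def prod.case a_def
      by auto
    then show ?thesis by blast
  qed
  moreover have "D i \<subseteq> space M" for i using D_sets sets.sets_into_space by blast
  ultimately have U: "(\<Union>i. D i) = space M" by blast
  show thesis
  proof (rule that[of "disjointed D" "\<lambda>i. snd (prod_decode i)"])
    show "disjointed D i \<in> sets M" for i
      using D_sets sets.range_disjointed_sets[of D M] by blast
    show "(\<Union>i. disjointed D i) = space M" using U by (simp add: UN_disjointed_eq)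
    fix i y assume "y \<in> disjointed D i"
    with disjointed_subset[of D i] have y: "y \<in> D i" by (rule subsetD)
    show "card (fib (r y)) = snd (prod_decode i)" using D1(2)[OF y] .
    have "disjointed D i \<inter> fib (r y) \<subseteq> {y}"
      unfolding D1(1)[OF y, symmetric] by (intro Int_mono disjointed_subset order_refl)
    moreover have "y \<in> fib (r y)" using D1(1)[OF y] by (metis IntE insertI1)
    ultimately show "disjointed D i \<inter> fib (r y) = {y}"
      using \<open>y \<in> disjointed D i\<close> by (intro antisym) simp_all
  qed (rule disjoint_family_disjointed)
qed

end

section \<open>Transfer of frames along the endomorphism\<close>

locale fibre_partition = strongly_invariant_endomorphism M r for M :: "'x measure" and r +
  fixes E :: "nat \<Rightarrow> 'x set" and c :: "nat \<Rightarrow> nat"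
  assumes E_sets [simp]: "\<And>i. E i \<in> sets M"
    and E_disjoint: "disjoint_family E"
    and E_union: "(\<Union>i. E i) = space M"
    and E_fibre: "\<And>i y. y \<in> E i \<Longrightarrow> E i \<inter> fib (r y) = {y}"
    and E_card: "\<And>i y. y \<in> E i \<Longrightarrow> card (fib (r y)) = c i"
begin

text \<open>For \<open>B\<close> inside \<open>E e\<close>, this is \<open>f\<close> composed with
  the inverse branch of \<open>r\<close> on \<open>B\<close>, extended by 0. The weight
  \<open>c e\<close> cancels the division by the fibre cardinality, and the form as a fibre mean
  makes the result measurable by strong invariance.\<close>

definition section_lift :: "nat \<Rightarrow> 'x set \<Rightarrow> ('x \<Rightarrow> complex) \<Rightarrow> 'x \<Rightarrow> complex" where
  "section_lift e B f = fibre_mean (\<lambda>y. of_nat (c e) * indicator B y * f y)"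

lemma section_lift_apply:
  assumes B: "B \<subseteq> E e" and y: "y \<in> B"
  shows "section_lift e B f (r y) = f y"
proof -
  have yE: "y \<in> E e" using assms by blast
  then have ys: "y \<in> space M" using E_union by blast
  have "B \<inter> fib (r y) \<subseteq> {y}" using E_fibre[OF yE] B by blast
  then have "indicator B z = (0::complex)" if "z \<in> fib (r y) - {y}" for z
    using that by (auto split: split_indicator)
  then have "(\<Sum>z\<in>fib (r y). of_nat (c e) * indicator B z * f z) = (\<Sum>z\<in>{y}. of_nat (c e) * indicator B z * f z)"
    using fibre_self[OF ys] finite_fibre[OF r_space[OF ys]] by (intro sum.mono_neutral_right) auto
  then show ?thesis
    using y card_fibre_pos[OF r_space[OF ys]] E_card[OF yE]
    by (simp add: section_lift_def fibre_mean_def)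
qed

lemma section_lift_eq_0:
  assumes "x \<notin> r ` B"
  shows "section_lift e B f x = 0"
proof -
  have "(\<Sum>z\<in>fib x. of_nat (c e) * indicator B z * f z) = 0"
    using assms by (intro sum.neutral) (auto simp: fibre_def split: split_indicator)
  then show ?thesis by (simp add: section_lift_def fibre_mean_def)
qed

lemma section_lift_measurable:
  assumes "B \<in> sets M" "f \<in> Linf M" shows "section_lift e B f \<in> borel_measurable M"
  unfolding section_lift_def using assms by (intro fibre_mean_measurable Linf_mult Linf_const Linf_indicator)

text \<open>The image is the level set at 1 of the lift of the constant 1, which makes it measurable
  although images under measurable maps need not be.\<close>

lemma image_sets:
  assumes B: "B \<in> sets M" "B \<subseteq> E e" shows "r ` B \<in> sets M"
proof -
  have "section_lift e B (\<lambda>_. 1) -` {1} \<inter> space M \<in> sets M"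
    using section_lift_measurable[OF B(1) Linf_const] by (rule measurable_sets) simp
  also have "section_lift e B (\<lambda>_. 1) -` {1} \<inter> space M = r ` B"
  proof (intro set_eqI iffI)
    fix x assume "x \<in> section_lift e B (\<lambda>_. 1) -` {1} \<inter> space M"
    then show "x \<in> r ` B" using section_lift_eq_0[of x B e "\<lambda>_. 1"] by auto
  next
    fix x assume "x \<in> r ` B"
    then obtain y where y: "y \<in> B" "x = r y" by blast
    then have "x \<in> space M" using B E_union r_space by blast
    with y show "x \<in> section_lift e B (\<lambda>_. 1) -` {1} \<inter> space M"
      using section_lift_apply[OF B(2)] by simp
  qed
  finally show ?thesis .
qed

text \<open>Change of variables along the inverse branch: \<open>r\<close> carries
  \<open>c e\<close> times the measure on \<open>B\<close> to the measure on the image of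
  \<open>B\<close>.\<close>

lemma integral_section:
  assumes B: "B \<in> sets M" "B \<subseteq> E e" and g: "g \<in> Linf M"
  shows "(LINT y|M. of_nat (c e) * indicator B y * g (r y)) = (LINT x|M. g x * indicator (r ` B) x)"
proof -
  have "(LINT y|M. of_nat (c e) * indicator B y * g (r y)) = (LINT x|M. section_lift e B (\<lambda>y. g (r y)) x)"
    unfolding section_lift_def using B g
    by (intro integral_fibre_mean Linf_mult Linf_const Linf_indicator Linf_comp')
  also have "\<dots> = (LINT x|M. g x * indicator (r ` B) x)"
  proof (intro Bochner_Integration.integral_cong refl)
    fix x
    show "section_lift e B (\<lambda>y. g (r y)) x = g x * indicator (r ` B) x"
    proof (cases "x \<in> r ` B")
      case True
      then obtain y where "y \<in> B" "x = r y" by blast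
      then show ?thesis using True section_lift_apply[OF B(2), of y] by simp
    qed (simp add: section_lift_eq_0)
  qed
  finally show ?thesis .
qed

text \<open>As \<open>r\<close> is injective on \<open>E e\<close>, every bounded function there
  factors through \<open>r\<close>. This lets completeness be tested with functions of the form
  \<open>g \<circ> r\<close>.\<close>

lemma ex_lift:
  assumes h: "h \<in> borel_measurable M" "\<And>x. cmod (h x) \<le> 1"
  shows "\<exists>g\<in>Linf M. \<forall>y\<in>E e. g (r y) = h y"
proof
  have "h \<in> Linf M" using h by (rule Linf_intro)
  show "section_lift e (E e) h \<in> Linf M"
  proof (rule Linf_intro)
    show "section_lift e (E e) h \<in> borel_measurable M"
      using \<open>h \<in> Linf M\<close> by (intro section_lift_measurable) simp_all
    show "cmod (section_lift e (E e) h x) \<le> 1" for x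
    proof (cases "x \<in> r ` E e")
      case True
      then show ?thesis using h(2) by (auto simp: section_lift_apply)
    qed (simp add: section_lift_eq_0)
  qed
  show "\<forall>y\<in>E e. section_lift e (E e) h (r y) = h y"
    using section_lift_apply[of "E e" e] by blast
qed

text \<open>Fibrewise, \<open>K1\<close> at \<open>x\<close> is the direct sum of \<open>K0\<close>
  over the points of the fibre of \<open>x\<close>. Hence the frame vectors of \<open>K0\<close>,
  cut down to the sets \<open>E e\<close>, become separate vectors of \<open>K1\<close>, indexed by
  pairs coded as natural numbers.\<close>

lemma frame_transfer:
  assumes K0: "Linf_module M \<pi> K0" and K1: "Linf_module M \<pi> K1"
    and U_in: "\<And>v. v \<in> K1 \<Longrightarrow> U v \<in> K0" and U_onto: "\<And>w. w \<in> K0 \<Longrightarrow> \<exists>v\<in>K1. U v = w"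
    and U_iso: "\<And>v w. cinner (U v) (U w) = cinner v w"
    and U_rep: "\<And>g v. g \<in> Linf M \<Longrightarrow> v \<in> K1 \<Longrightarrow> U (\<pi> g v) = \<pi> (g \<circ> r) (U v)"
    and fr: "Linf_module.frame M \<pi> K0 k A"
  shows "\<exists>k'. Linf_module.frame M \<pi> K1 k' (\<lambda>i. case prod_decode i of (e, n) \<Rightarrow> r ` (E e \<inter> A n))"
proof -
  interpret K0: Linf_module M \<pi> K0 by (rule K0)
  interpret K1: Linf_module M \<pi> K1 by (rule K1)
  have k: "k n \<in> K0" and A: "A n \<in> sets M" for n using fr by (auto simp: K0.frame_def)
  have kk: "K0.has_density (k n) (k p) (if n = p then indicator (A n) else (\<lambda>x. 0))" for n p
    using fr by (auto simp: K0.frame_def)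
  \<comment> \<open>The square root normalises the transported vectors: its square is the weight
    \<open>c e\<close> in the change of variables \<open>integral_section\<close>.\<close>
  define w where "w e x = complex_of_real (sqrt (c e)) * indicator (E e) x" for e x
  have w: "w e \<in> Linf M" for e unfolding w_def by simp
  define u where "u i = (case prod_decode i of (e, n) \<Rightarrow> \<pi> (w e) (k n))" for i
  have "\<exists>v\<in>K1. U v = u i" for i
    using w k by (intro U_onto) (auto simp: u_def split: prod.split)
  then obtain k' where k': "k' i \<in> K1" and Uk': "U (k' i) = u i" for i by metis
  define A' where "A' i = (case prod_decode i of (e, n) \<Rightarrow> r ` (E e \<inter> A n))" for i
  have A': "A' i \<in> sets M" for i
    unfolding A'_def by (simp split: prod.split add: image_sets[OF sets.Int[OF E_sets A] Int_lower1])
  have dens: "cinner (k' i) (\<pi> g (k' j)) = (LINT x|M. g x * (if i = j then indicator (A' i) else (\<lambda>x. 0)) x)"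
    if g: "g \<in> Linf M" for g i j
  proof -
    obtain e n where i: "prod_decode i = (e, n)" by (rule prod.exhaust)
    obtain e' n' where j: "prod_decode j = (e', n')" by (rule prod.exhaust)
    have gw: "(\<lambda>x. (g \<circ> r) x * w e' x) \<in> Linf M"
      by (rule Linf_mult[OF Linf_comp[OF g] w])
    have f: "(\<lambda>x. cnj (w e x) * ((g \<circ> r) x * w e' x)) \<in> Linf M"
      by (rule Linf_mult[OF Linf_cnj[OF w] gw])
    have "cinner (k' i) (\<pi> g (k' j)) = cinner (u i) (\<pi> (g \<circ> r) (u j))"
      by (simp only: U_iso[symmetric, of "k' i"] U_rep[OF g k'] Uk')
    also have "\<dots> = cinner (\<pi> (w e) (k n)) (\<pi> (\<lambda>x. (g \<circ> r) x * w e' x) (k n'))"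
      by (simp only: u_def i j prod.case K0.rep_mult[OF Linf_comp[OF g] w k])
    also have "\<dots> = cinner (k n) (\<pi> (\<lambda>x. cnj (w e x) * ((g \<circ> r) x * w e' x)) (k n'))"
      by (rule K0.cinner_rep_rep[OF w gw k k])
    also have "\<dots> = (LINT x|M. cnj (w e x) * ((g \<circ> r) x * w e' x) * (if n = n' then indicator (A n) else (\<lambda>x. 0)) x)"
      by (rule K0.has_densityD[OF kk f])
    also have "\<dots> = (LINT x|M. g x * (if i = j then indicator (A' i) else (\<lambda>x. 0)) x)"
    proof (cases "i = j")
      case True
      then have e: "e' = e" "n' = n" using i j by auto
      have sq: "complex_of_real (sqrt (real (c e))) * complex_of_real (sqrt (real (c e))) = of_nat (c e)"
        by (simp flip: of_real_mult)
      have "cnj (w e x) * ((g \<circ> r) x * w e x) * indicator (A n) x =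
          of_nat (c e) * indicator (E e \<inter> A n) x * g (r x)" for x
        by (simp add: w_def sq[symmetric] split: split_indicator)
      then have "(LINT x|M. cnj (w e x) * ((g \<circ> r) x * w e x) * indicator (A n) x) =
          (LINT x|M. of_nat (c e) * indicator (E e \<inter> A n) x * g (r x))"
        by (simp only:)
      also have "\<dots> = (LINT x|M. g x * indicator (r ` (E e \<inter> A n)) x)"
        using A g by (intro integral_section) auto
      also have "r ` (E e \<inter> A n) = A' i" by (simp add: A'_def i)
      finally show ?thesis using True by (simp add: e)
    next
      case False
      \<comment> \<open>Distinct index pairs differ in the frame index, where the frame of
        \<open>K0\<close> is orthogonal, or else in the piece, where the supports \<open>E e\<close>
        and \<open>E e'\<close> are disjoint.\<close>
      have "cnj (w e x) * ((g \<circ> r) x * w e' x) * (if n = n' then indicator (A n) else (\<lambda>x. 0)) x = 0" for x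
      proof (cases "n = n'")
        case True
        with False i j have "e \<noteq> e'" by (metis prod_decode_inverse)
        then have "E e \<inter> E e' = {}" using E_disjoint by (auto simp: disjoint_family_on_def)
        then show ?thesis by (auto simp: w_def split: split_indicator)
      qed simp
      then show ?thesis
        using False by (simp only: if_False mult_zero_right Bochner_Integration.integral_zero)
    qed
    finally show ?thesis .
  qed
  have "K1.frame k' A'"
    unfolding K1.frame_def
  proof (intro conjI allI ballI impI)
    show "k' i \<in> K1" "A' i \<in> sets M" for i by (rule k', rule A')
    show "K1.has_density (k' i) (k' j) (if i = j then indicator (A' i) else (\<lambda>x. 0))" for i j
      unfolding K1.has_density_def
    proof (intro conjI ballI dens)
      show "integrable M (if i = j then indicator (A' i) else (\<lambda>x. 0) :: 'x \<Rightarrow> complex)"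
        using integrable_Linf[OF Linf_indicator[OF A']] by simp
    qed
    fix v assume v: "v \<in> K1" and orth: "\<forall>i. \<forall>g\<in>Linf M. cinner (\<pi> g (k' i)) v = 0"
    note Uv = U_in[OF v]
    have "cinner (\<pi> f (k n)) (U v) = 0" if f: "f \<in> Linf M" for f n
    proof -
      obtain d where d: "K0.has_density (k n) (U v) d" using K0.ex_has_density[OF k Uv] by blast
      note id = K0.has_density_integrable[OF d]
      have "AE x in M. w e x * d x = 0" for e
      proof (rule AE_eq_zero_if_orthogonal_bounded)
        show "integrable M (\<lambda>x. w e x * d x)" using w id by (rule integrable_Linf_mult)
        fix h :: "'x \<Rightarrow> complex" assume h: "h \<in> borel_measurable M" "\<And>x. cmod (h x) \<le> 1"
        have h': "(\<lambda>x. cnj (h x)) \<in> borel_measurable M" "\<And>x. cmod (cnj (h x)) \<le> 1"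
          using h by (auto intro: borel_measurable_cnj)
        \<comment> \<open>Choosing \<open>g \<circ> r\<close> equal to the conjugate of
          \<open>h\<close> on \<open>E e\<close> tests \<open>w e x * d x\<close> against an
          arbitrary bounded \<open>h\<close>, since \<open>w e\<close> vanishes off
          \<open>E e\<close>.\<close>
        obtain g where g: "g \<in> Linf M" "\<And>y. y \<in> E e \<Longrightarrow> g (r y) = cnj (h y)"
          using ex_lift[OF h', of e] by blast
        have gw: "(\<lambda>x. (g \<circ> r) x * w e x) \<in> Linf M"
          by (rule Linf_mult[OF Linf_comp[OF g(1)] w])
        have "0 = cinner (\<pi> g (k' (prod_encode (e, n)))) v" using orth g(1) by simp
        also have "\<dots> = cinner (\<pi> (g \<circ> r) (u (prod_encode (e, n)))) (U v)"
          by (simp only: U_iso[symmetric, of "\<pi> g (k' (prod_encode (e, n)))"] U_rep[OF g(1) k'] Uk')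
        also have "\<dots> = cinner (\<pi> (\<lambda>x. (g \<circ> r) x * w e x) (k n)) (U v)"
          by (simp only: u_def prod_encode_inverse prod.case K0.rep_mult[OF Linf_comp[OF g(1)] w k])
        also have "\<dots> = (LINT x|M. cnj ((g \<circ> r) x * w e x) * d x)"
          by (simp only: K0.cinner_rep_left[OF gw k Uv] K0.has_densityD[OF d Linf_cnj[OF gw]])
        also have "\<dots> = (LINT x|M. h x * (w e x * d x))"
          by (intro Bochner_Integration.integral_cong refl) (auto simp: w_def g(2) split: split_indicator)
        finally show "(LINT x|M. h x * (w e x * d x)) = 0" by simp
      qed
      then have "AE x in M. \<forall>e. w e x * d x = 0" unfolding AE_all_countable by blast
      \<comment> \<open>Each point lies in some \<open>E e\<close>, and there \<open>w e\<close> is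
        nonzero because the fibre cardinality \<open>c e\<close> is positive.\<close>
      with AE_space have "AE x in M. d x = 0"
      proof eventually_elim
        case (elim x)
        then obtain e where e: "x \<in> E e" using E_union by blast
        then have "0 < c e" using card_fibre_pos[OF r_space[OF elim(1)]] E_card by metis
        with elim(2) e show ?case by (auto simp: w_def dest: spec[of _ e])
      qed
      then have "(LINT x|M. cnj (f x) * d x) = 0"
        by (intro integral_eq_zero_AE) (auto elim: eventually_mono)
      then show ?thesis
        by (simp only: K0.cinner_rep_left[OF f k Uv] K0.has_densityD[OF d Linf_cnj[OF f]])
    qed
    then have "U v = 0" using fr Uv unfolding K0.frame_def by blast
    then have "cinner v v = 0" using U_iso[of v v] by simp
    then show "v = 0" by (simp add: cinner_self)
  qed
  then show ?thesis unfolding A'_def by blast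
qed

text \<open>The indicator of each image is a sum over the fibre with at most one nonzero term. After
  interchanging sums, the sum over \<open>e\<close> is 1 because the \<open>E e\<close> partition
  the space, and the sum over \<open>n\<close> counts \<open>m y\<close>.\<close>

lemma transferred_count:
  assumes x: "x \<in> space M"
  shows "(\<Sum>i. indicator (case prod_decode i of (e, n) \<Rightarrow> r ` (E e \<inter> {y\<in>space M. enat n < m y})) x) =
    ennreal_of_enat (\<Sum>y\<in>fib x. m y)"
proof -
  let ?A = "\<lambda>n. {y\<in>space M. enat n < m y}"
  have ind: "indicator (r ` (E e \<inter> ?A n)) x =
      (\<Sum>y\<in>fib x. indicator (E e) y * (if enat n < m y then 1 else 0 :: ennreal))" for e n
  proof (cases "x \<in> r ` (E e \<inter> ?A n)")
    case True
    then obtain y where y: "y \<in> E e" "y \<in> space M" "enat n < m y" "x = r y" by blast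
    have "indicator (E e) z = (0::ennreal)" if "z \<in> fib x - {y}" for z
      using that E_fibre[OF y(1)] y(4) by (auto split: split_indicator)
    then have "(\<Sum>z\<in>fib x. indicator (E e) z * (if enat n < m z then 1 else 0 :: ennreal)) =
        (\<Sum>z\<in>{y}. indicator (E e) z * (if enat n < m z then 1 else 0))"
      using y fibre_self[OF y(2)] finite_fibre[OF x] by (intro sum.mono_neutral_right) auto
    then show ?thesis using True y by simp
  next
    case False
    then have "(\<Sum>y\<in>fib x. indicator (E e) y * (if enat n < m y then 1 else 0 :: ennreal)) = 0"
      by (intro sum.neutral) (auto simp: fibre_def split: split_indicator)
    with False show ?thesis by simp
  qed
  have "(\<Sum>i. indicator (case prod_decode i of (e, n) \<Rightarrow> r ` (E e \<inter> ?A n)) x) =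
      (\<Sum>e. \<Sum>n. indicator (r ` (E e \<inter> ?A n)) x :: ennreal)"
    using suminf_ennreal_2dimen[of "\<lambda>e. \<Sum>n. indicator (r ` (E e \<inter> ?A n)) x" "\<lambda>(e, n). indicator (r ` (E e \<inter> ?A n)) x"]
    by (simp add: case_prod_beta)
  also have "\<dots> = (\<Sum>e. \<Sum>y\<in>fib x. indicator (E e) y * ennreal_of_enat (m y))"
    unfolding ind by (simp add: suminf_sum ennreal_suminf_cmult suminf_indicator_less_enat)
  also have "\<dots> = (\<Sum>y\<in>fib x. (\<Sum>e. indicator (E e) y) * ennreal_of_enat (m y))"
    by (simp add: suminf_sum ennreal_suminf_multc)
  also have "\<dots> = (\<Sum>y\<in>fib x. ennreal_of_enat (m y))"
  proof (intro sum.cong refl)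
    fix y assume "y \<in> fib x"
    then have "y \<in> (\<Union>e. E e)" by (simp add: E_union fibre_def)
    then have "(\<Sum>e. indicator (E e) y :: ennreal) = 1"
      using suminf_indicator[OF E_disjoint, of y] by simp
    then show "(\<Sum>e. indicator (E e) y) * ennreal_of_enat (m y) = ennreal_of_enat (m y)" by simp
  qed
  finally show ?thesis by simp
qed

end

section \<open>Orthogonal sums\<close>

lemma parallelogram_norm:
  fixes a b :: "'a::real_inner"
  shows "(norm (a - b))\<^sup>2 = 2 * (norm a)\<^sup>2 + 2 * (norm b)\<^sup>2 - (norm (a + b))\<^sup>2"
  by (simp add: power2_norm_eq_inner inner_add_left inner_add_right inner_diff_left inner_diff_right)

text \<open>A minimising sequence for the distance from \<open>v\<close> to \<open>K\<close> is
  Cauchy by the parallelogram law; its limit \<open>p\<close> is a nearest point, and the first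
  variation of the distance at \<open>p\<close> vanishes.\<close>

lemma orthogonal_projection_exists:
  fixes v :: "'h::complex_hilbert"
  assumes K: "csubspace K" "closed K"
  obtains p where "p \<in> K" "\<And>k. k \<in> K \<Longrightarrow> cinner k (v - p) = 0"
proof -
  have ne: "K \<noteq> {}" using complex_vector.subspace_0[OF K(1)] by blast
  define d where "d = infdist v K"
  have d0: "0 \<le> d" by (simp add: d_def infdist_nonneg)
  have d_le: "d \<le> norm (v - k)" if "k \<in> K" for k
    using infdist_le[OF that, of v] by (simp add: d_def dist_norm)
  have "\<exists>k\<in>K. norm (v - k) < d + inverse (Suc n)" for n
  proof (rule ccontr)
    assume "\<not> ?thesis"
    then have "d + inverse (Suc n) \<le> dist v k" if "k \<in> K" for k
      using that by (force simp: dist_norm)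
    then have "d + inverse (Suc n) \<le> (INF k\<in>K. dist v k)"
      using ne by (intro cINF_greatest)
    then show False using ne by (simp add: d_def infdist_def)
  qed
  then obtain x where x: "\<And>n. x n \<in> K" and xd: "\<And>n. norm (v - x n) < d + inverse (Suc n)"
    by metis
  have bound: "(norm (x m - x n))\<^sup>2 \<le> 4 * (2 * d + 1) * inverse (Suc N)" if "N \<le> m" "N \<le> n" for N m n
  proof -
    let ?e = "inverse (real (Suc N))"
    have e: "0 < ?e" "?e \<le> 1" by (simp_all add: field_simps)
    have le: "(norm (v - x m))\<^sup>2 \<le> (d + ?e)\<^sup>2" if "N \<le> m" for m
    proof -
      have "inverse (real (Suc m)) \<le> ?e" using that by (intro le_imp_inverse_le) auto
      then have "norm (v - x m) \<le> d + ?e" using xd[of m] by linarith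
      then show ?thesis by (intro power_mono) auto
    qed
    \<comment> \<open>The midpoint lies in \<open>K\<close>, so it too has distance at least
      \<open>d\<close> from \<open>v\<close>; this bounds the sum in the parallelogram law from
      below.\<close>
    have "(1/2) *\<^sub>R (x m + x n) \<in> K"
      using x by (intro csubspace_scaleR K complex_vector.subspace_add)
    then have "d \<le> norm (v - (1/2) *\<^sub>R (x m + x n))" by (rule d_le)
    moreover have "(v - x m) + (v - x n) = 2 *\<^sub>R (v - (1/2) *\<^sub>R (x m + x n))"
      by (simp add: algebra_simps scaleR_2)
    ultimately have "2 * d \<le> norm ((v - x m) + (v - x n))" by simp
    then have "(2 * d)\<^sup>2 \<le> (norm ((v - x m) + (v - x n)))\<^sup>2" using d0 by (intro power_mono) auto
    moreover have "norm (x m - x n) = norm ((v - x n) - (v - x m))" by simp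
    ultimately have "(norm (x m - x n))\<^sup>2 \<le> 4 * (d + ?e)\<^sup>2 - 4 * d\<^sup>2"
      using parallelogram_norm[of "v - x n" "v - x m"] le[OF that(1)] le[OF that(2)]
      by (simp add: power_mult_distrib add.commute)
    also have "\<dots> = 4 * (2 * d + ?e) * ?e" by (simp add: power2_eq_square algebra_simps)
    also have "\<dots> \<le> 4 * (2 * d + 1) * ?e" using e by (intro mult_right_mono) auto
    finally show ?thesis .
  qed
  have "Cauchy x"
  proof (rule CauchyI')
    fix e :: real assume e: "0 < e"
    then have "0 < e\<^sup>2 / (4 * (2 * d + 1))" using d0 by simp
    then obtain N where N: "inverse (real (Suc N)) < e\<^sup>2 / (4 * (2 * d + 1))"
      using reals_Archimedean by blast
    then have N': "4 * (2 * d + 1) * inverse (real (Suc N)) < e\<^sup>2"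
      using d0 by (simp add: pos_less_divide_eq mult.commute)
    show "\<exists>N. \<forall>m\<ge>N. \<forall>n>m. dist (x m) (x n) < e"
    proof (intro exI[of _ N] allI impI)
      fix m n assume "N \<le> m" "m < n"
      then have "(norm (x m - x n))\<^sup>2 < e\<^sup>2" using bound[of N m n] N' by linarith
      then show "dist (x m) (x n) < e" using e by (simp add: dist_norm power2_less_imp_less)
    qed
  qed
  then obtain p where p: "x \<longlonglongrightarrow> p" using Cauchy_convergent by (auto simp: convergent_def)
  have pK: "p \<in> K" using closed_sequentially[OF K(2) x p] .
  have "norm (v - p) \<le> d + 0"
  proof (rule LIMSEQ_le)
    show "(\<lambda>n. norm (v - x n)) \<longlonglongrightarrow> norm (v - p)" using p by (intro tendsto_intros)
    show "(\<lambda>n. d + inverse (real (Suc n))) \<longlonglongrightarrow> d + 0"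
      by (intro tendsto_add tendsto_const LIMSEQ_inverse_real_of_nat)
    show "\<exists>N. \<forall>n\<ge>N. norm (v - x n) \<le> d + inverse (real (Suc n))" using xd less_imp_le by blast
  qed
  then have vp: "norm (v - p) \<le> norm (v - k)" if "k \<in> K" for k using d_le[OF that] by linarith
  have real0: "k \<bullet> (v - p) = 0" if k: "k \<in> K" for k
  proof (rule ccontr)
    assume n0: "k \<bullet> (v - p) \<noteq> 0"
    define a where "a = k \<bullet> (v - p)"
    define b where "b = k \<bullet> k"
    have b: "0 < b" using n0 by (auto simp: b_def)
    \<comment> \<open>The minimiser of the quadratic that gives the squared distance from
      \<open>v\<close> to \<open>p + t *\<^sub>R k\<close>; with it that point would be closer to
      \<open>v\<close> than \<open>p\<close>.\<close>
    define t where "t = a / b"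
    have "p + t *\<^sub>R k \<in> K" using k pK by (intro csubspace_scaleR K complex_vector.subspace_add)
    then have "(norm (v - p))\<^sup>2 \<le> (norm (v - (p + t *\<^sub>R k)))\<^sup>2" by (intro power_mono vp) auto
    also have "v - (p + t *\<^sub>R k) = (v - p) - t *\<^sub>R k" by simp
    also have "(norm ((v - p) - t *\<^sub>R k))\<^sup>2 = (norm (v - p))\<^sup>2 - 2 * t * a + t\<^sup>2 * b"
      unfolding power2_norm_eq_inner a_def b_def inner_diff_left[of "v - p"] inner_diff_right[of _ "v - p"]
      by (simp add: inner_commute[of "v - p" k] power2_eq_square)
    finally have "2 * t * a \<le> t\<^sup>2 * b" by simp
    moreover have "t\<^sup>2 * b = a\<^sup>2 / b" "t * a = a\<^sup>2 / b" using b by (simp_all add: t_def power2_eq_square)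
    ultimately have "a\<^sup>2 / b \<le> 0" by simp
    moreover have "0 < a\<^sup>2 / b" using b n0 by (simp add: a_def)
    ultimately show False by linarith
  qed
  have "cinner k (v - p) = 0" if k: "k \<in> K" for k
  proof (rule complex_eqI)
    show "Re (cinner k (v - p)) = Re 0" using real0[OF k] by (simp add: inner_eq_Re_cinner)
    have "\<i> *\<^sub>C k \<in> K" using k K by (intro complex_vector.subspace_scale)
    then show "Im (cinner k (v - p)) = Im 0" using real0 by (simp add: Im_cinner)
  qed
  with pK show thesis by (rule that)
qed

text \<open>The two frames are merged through pairs \<open>(s, n)\<close>, with \<open>s\<close>
  being 0 for \<open>U\<close> and 1 for its complement. Larger \<open>s\<close> pads with the zero
  vector and the empty set, which adds nothing to a frame.\<close>

lemma frame_orthogonal_sum: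
  assumes V: "Linf_module M \<pi> V" and U: "Linf_module M \<pi> U" and W: "Linf_module M \<pi> (V \<ominus> U)"
    and UV: "U \<subseteq> V"
    and k: "Linf_module.frame M \<pi> U k A" and l: "Linf_module.frame M \<pi> (V \<ominus> U) l B"
  shows "\<exists>q. Linf_module.frame M \<pi> V q
    (\<lambda>i. case prod_decode i of (s, n) \<Rightarrow> if s = 0 then A n else if s = 1 then B n else {})"
proof -
  interpret V: Linf_module M \<pi> V by (rule V)
  interpret U: Linf_module M \<pi> U by (rule U)
  interpret W: Linf_module M \<pi> "V \<ominus> U" by (rule W)
  have k': "k n \<in> U" "A n \<in> sets M" for n using k by (auto simp: U.frame_def)
  have l': "l n \<in> V \<ominus> U" "B n \<in> sets M" for n using l by (auto simp: W.frame_def)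
  have WV: "V \<ominus> U \<subseteq> V" by (auto simp: ominus_def)
  have orth: "cinner u w = 0" "cinner w u = 0" if "u \<in> U" "w \<in> V \<ominus> U" for u w
    using that cinner_commute[of w u] by (auto simp: ominus_def)
  define Q where "Q s n = (if s = 0 then k n else if s = 1 then l n else 0)" for s n :: nat
  define C where "C s n = (if s = 0 then A n else if s = 1 then B n else {})" for s n :: nat
  have Q_in: "Q s n \<in> V" for s n
    using k'(1)[of n] l'(1)[of n] UV WV complex_vector.subspace_0[OF V.subspace] by (auto simp: Q_def)
  have C_in: "C s n \<in> sets M" for s n
    using k'(2) l'(2) by (simp add: C_def)
  have zero_right: "cinner v (\<pi> g 0) = 0" if "g \<in> Linf M" "v \<in> V" for g v
    using V.cinner_rep_left[OF Linf_cnj[OF that(1)] that(2) complex_vector.subspace_0[OF V.subspace]] by simp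
  have kk: "cinner (k n) (\<pi> g (k p)) = (LINT x|M. g x * (if n = p then indicator (A n) else (\<lambda>x. 0)) x)"
    if "g \<in> Linf M" for n p g
    using k that unfolding U.frame_def U.has_density_def by blast
  have ll: "cinner (l n) (\<pi> g (l p)) = (LINT x|M. g x * (if n = p then indicator (B n) else (\<lambda>x. 0)) x)"
    if "g \<in> Linf M" for n p g
    using l that unfolding W.frame_def W.has_density_def by blast
  have dens: "cinner (Q s n) (\<pi> g (Q t p)) =
      (LINT x|M. g x * (if (s, n) = (t, p) then indicator (C s n) else (\<lambda>x. 0)) x)" if g: "g \<in> Linf M" for s n t p g
  proof -
    consider "s = 0" "t = 0" | "s = 0" "t = 1" | "s = 1" "t = 0" | "s = 1" "t = 1" | "s \<ge> 2" | "t \<ge> 2" by linarith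
    then show ?thesis
    proof cases
      case 1
      then show ?thesis using kk[OF g, of n p] by (simp add: Q_def C_def)
    next
      case 2
      then show ?thesis using orth(1)[OF k'(1) W.rep_in[OF g l'(1)]] by (simp add: Q_def)
    next
      case 3
      then show ?thesis using orth(2)[OF U.rep_in[OF g k'(1)] l'(1)] by (simp add: Q_def)
    next
      case 4
      then show ?thesis using ll[OF g, of n p] by (simp add: Q_def C_def)
    next
      case 5
      then show ?thesis by (simp add: Q_def C_def)
    next
      case 6
      then show ?thesis using zero_right[OF g Q_in] by (simp add: Q_def[of t] C_def)
    qed
  qed
  define q where "q i = (case prod_decode i of (s, n) \<Rightarrow> Q s n)" for i
  define D where "D i = (case prod_decode i of (s, n) \<Rightarrow> C s n)" for i
  have "V.frame q D"
    unfolding V.frame_def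
  proof (intro conjI allI ballI impI)
    show "q i \<in> V" for i using Q_in by (simp add: q_def split: prod.split)
    show "D i \<in> sets M" for i using C_in by (simp add: D_def split: prod.split)
    show "V.has_density (q i) (q j) (if i = j then indicator (D i) else (\<lambda>x. 0))" for i j
      unfolding V.has_density_def
    proof (intro conjI ballI)
      show "integrable M (if i = j then indicator (D i) else (\<lambda>x. 0) :: _ \<Rightarrow> complex)"
        using V.integrable_Linf[OF Linf_indicator[OF C_in]] by (simp add: D_def split: prod.split)
      fix g assume g: "g \<in> Linf M"
      obtain s n where i: "prod_decode i = (s, n)" by (rule prod.exhaust)
      obtain t p where j: "prod_decode j = (t, p)" by (rule prod.exhaust)
      have "(i = j) = ((s, n) = (t, p))" using i j by (metis prod_decode_inverse)
      then show "cinner (q i) (\<pi> g (q j)) = (LINT x|M. g x * (if i = j then indicator (D i) else (\<lambda>x. 0)) x)"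
        unfolding q_def D_def i j prod.case using dens[OF g, of s n t p] by (simp only:)
    qed
    fix v assume v: "v \<in> V" and 0: "\<forall>i. \<forall>g\<in>Linf M. cinner (\<pi> g (q i)) v = 0"
    have 0: "cinner (\<pi> g (Q s n)) v = 0" if "g \<in> Linf M" for g s n
      using 0[rule_format, of g "prod_encode (s, n)"] that by (simp add: q_def)
    \<comment> \<open>Orthogonality to the first frame forces the component of \<open>v\<close> in
      \<open>U\<close> to be zero, then orthogonality to the second frame forces the rest to be
      zero.\<close>
    obtain p where p: "p \<in> U" and perp: "\<And>u. u \<in> U \<Longrightarrow> cinner u (v - p) = 0"
      using orthogonal_projection_exists[OF U.subspace U.closed, of v thesis] by blast
    have vp: "v - p \<in> V \<ominus> U"
      using v p UV perp complex_vector.subspace_diff[OF V.subspace, of v p] by (auto simp: ominus_def)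
    have "cinner (\<pi> g (k n)) p = 0" if g: "g \<in> Linf M" for g n
      using 0[OF g, of 0 n] perp[OF U.rep_in[OF g k'(1)[of n]]] by (simp add: Q_def cinner_diff_right)
    then have "p = 0" using k p unfolding U.frame_def by blast
    have "cinner (\<pi> g (l n)) (v - p) = 0" if g: "g \<in> Linf M" for g n
      using 0[OF g, of 1 n] by (simp add: Q_def \<open>p = 0\<close>)
    then have "v - p = 0" using l vp unfolding W.frame_def by blast
    then show "v = 0" using \<open>p = 0\<close> by simp
  qed
  then show ?thesis unfolding D_def C_def by blast
qed

text \<open>The padding by empty sets leaves just the terms for \<open>s\<close> equal to 0 and
  1.\<close>

lemma orthogonal_sum_count:
  assumes x: "x \<in> X"
  shows "(\<Sum>i. indicator (case prod_decode i of (s, p) \<Rightarrow>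
      if s = 0 then {y\<in>X. enat p < m y} else if s = 1 then {y\<in>X. enat p < n y} else {}) x)
    = ennreal_of_enat (m x + n x)"
proof -
  let ?A = "\<lambda>s p. if s = (0::nat) then {y\<in>X. enat p < m y} else if s = 1 then {y\<in>X. enat p < n y} else {}"
  let ?f = "\<lambda>s. \<Sum>p. indicator (?A s p) x :: ennreal"
  have "(\<Sum>i. indicator (case prod_decode i of (s, p) \<Rightarrow> ?A s p) x) = (\<Sum>s. ?f s)"
    by (rule suminf_ennreal_2dimen[of ?f "\<lambda>z. indicator (case z of (s, p) \<Rightarrow> ?A s p) x"])
      (simp only: prod.case)
  also have "\<dots> = (\<Sum>s\<in>{0,1}. ?f s)"
    by (rule suminf_finite) auto
  also have "\<dots> = ennreal_of_enat (m x) + ennreal_of_enat (n x)"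
    using suminf_indicator_less_enat[of "m x"] suminf_indicator_less_enat[of "n x"] x
    by (simp add: indicator_def of_bool_def)
  finally show ?thesis by simp
qed

section \<open>Normal representations on subspaces\<close>

lemma Linf_representation_bounded:
  "Linf_representation M \<pi> K \<Longrightarrow> g \<in> Linf M \<Longrightarrow> \<pi> g \<in> bounded_operators K"
  unfolding Linf_representation_def by blast

lemma Linf_representation_in:
  "Linf_representation M \<pi> K \<Longrightarrow> g \<in> Linf M \<Longrightarrow> k \<in> K \<Longrightarrow> \<pi> g k \<in> K"
  using Linf_representation_bounded[of M \<pi> K g] unfolding bounded_operators_def by blast

lemma Linf_representation_subset:
  assumes rep: "Linf_representation M \<pi> L" and KL: "K \<subseteq> L"
    and inv: "\<And>g k. g \<in> Linf M \<Longrightarrow> k \<in> K \<Longrightarrow> \<pi> g k \<in> K"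
  shows "Linf_representation M \<pi> K"
proof -
  have "\<pi> g \<in> bounded_operators K" if "g \<in> Linf M" for g
  proof -
    have "\<pi> g \<in> bounded_operators L" using rep that by (rule Linf_representation_bounded)
    moreover have "\<pi> g ` K \<subseteq> K" using inv[OF that] by blast
    ultimately show ?thesis
      using KL unfolding bounded_operators_def clinear_on_def by blast
  qed
  note 0 = this and rep' = rep[unfolded Linf_representation_def]
  note 1 = rep'[THEN conjunct2, THEN conjunct1, rule_format]
  note 2 = rep'[THEN conjunct2, THEN conjunct2, THEN conjunct1, rule_format]
  note 3 = rep'[THEN conjunct2, THEN conjunct2, THEN conjunct2, THEN conjunct1, rule_format]
  note 4 = rep'[THEN conjunct2, THEN conjunct2, THEN conjunct2, THEN conjunct2, THEN conjunct1, rule_format]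
  note 5 = rep'[THEN conjunct2, THEN conjunct2, THEN conjunct2, THEN conjunct2, THEN conjunct2, rule_format]
  show ?thesis
    unfolding Linf_representation_def
  proof (intro conjI ballI allI impI)
    fix f g k c assume fg: "f \<in> Linf M" "g \<in> Linf M" and k: "k \<in> K"
    then have kL: "k \<in> L" using KL by blast
    show "\<pi> f k = \<pi> g k" if "AE x in M. f x = g x" by (rule 1[OF fg that kL])
    show "\<pi> (\<lambda>x. f x + g x) k = \<pi> f k + \<pi> g k" by (rule 2[OF fg kL])
    show "\<pi> (\<lambda>x. f x * g x) k = \<pi> f (\<pi> g k)" by (rule 4[OF fg kL])
  next
    fix c g k assume "g \<in> Linf M" "k \<in> K"
    then show "\<pi> (\<lambda>x. c * g x) k = c *\<^sub>C \<pi> g k" using KL by (intro 3) auto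
  next
    fix k assume "k \<in> K"
    then show "\<pi> (\<lambda>x. 1) k = k" using KL by (intro 5) auto
  qed (rule 0)
qed

lemma star_representationD:
  assumes "star_representation M \<pi> K" "g \<in> Linf M" "k \<in> K" "l \<in> K"
  shows "cinner k (\<pi> (\<lambda>x. cnj (g x)) l) = cinner (\<pi> g k) l"
proof -
  have "\<forall>g\<in>Linf M. \<forall>k\<in>K. \<forall>l\<in>K. cinner k (\<pi> (\<lambda>x. cnj (g x)) l) = cinner (\<pi> g k) l"
    using assms(1) unfolding star_representation_def by blast
  with assms(2-4) show ?thesis by blast
qed

lemma star_representation_subset:
  assumes star: "star_representation M \<pi> L" and KL: "K \<subseteq> L"
    and inv: "\<And>g k. g \<in> Linf M \<Longrightarrow> k \<in> K \<Longrightarrow> \<pi> g k \<in> K"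
  shows "star_representation M \<pi> K"
proof -
  from star have "Linf_representation M \<pi> L" by (simp only: star_representation_def)
  from Linf_representation_subset[OF this KL inv] have "Linf_representation M \<pi> K" .
  moreover have "cinner k (\<pi> (\<lambda>x. cnj (g x)) l) = cinner (\<pi> g k) l" if "g \<in> Linf M" "k \<in> K" "l \<in> K" for g k l
    using that KL by (intro star_representationD[OF star]) auto
  ultimately show ?thesis
    unfolding star_representation_def by (intro conjI ballI)
qed

section \<open>Normality through matrix coefficients\<close>

lemma topspace_weak_star_subset: "topspace (weak_star_topology M) \<subseteq> Linf M"
  unfolding weak_star_topology_def topology_generated_by_topspace by blast

text \<open>A coefficient with unrestricted values puts all of \<open>bounded_operators K\<close>
  into the subbasis; for empty \<open>K\<close> there would be no subbasic set.\<close>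

lemma topspace_weak_operator:
  assumes "K \<noteq> {}" shows "topspace (weak_operator_topology K) = bounded_operators K"
proof -
  from assms obtain k where "k \<in> K" by blast
  then have "{T \<in> bounded_operators K. cinner k (T k) \<in> UNIV} \<in>
      {{T \<in> bounded_operators K. cinner k (T l) \<in> U} | k l U. k \<in> K \<and> l \<in> K \<and> open U}" by blast
  then show ?thesis
    unfolding weak_operator_topology_def topology_generated_by_topspace by blast
qed

text \<open>The weak operator topology is generated by the matrix coefficients, so continuity into
  it is continuity of each of them.\<close>

lemma normal_representation_iff:
  assumes ne: "K \<noteq> {}"
  shows "normal_representation M \<pi> K \<longleftrightarrow> star_representation M \<pi> K \<and>
    (\<forall>C. \<forall>k\<in>K. \<forall>l\<in>K. continuous_map (subtopology (weak_star_topology M) (Linf_ball M C)) euclidean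
      (\<lambda>g. cinner k (\<pi> g l)))"
    (is "_ \<longleftrightarrow> _ \<and> ?R")
proof (cases "star_representation M \<pi> K")
  case star: True
  then have bdd: "\<pi> g \<in> bounded_operators K" if "g \<in> Linf M" for g
    using that unfolding star_representation_def by (blast intro: Linf_representation_bounded)
  let ?X = "\<lambda>C. subtopology (weak_star_topology M) (Linf_ball M C)"
  have X: "topspace (?X C) \<subseteq> Linf M" for C
    using topspace_weak_star_subset[of M] unfolding topspace_subtopology by blast
  have "(\<forall>C. continuous_map (?X C) (weak_operator_topology K) \<pi>) \<longleftrightarrow> ?R"
  proof
    assume cont: "\<forall>C. continuous_map (?X C) (weak_operator_topology K) \<pi>"
    show ?R
    proof (intro allI ballI)
      fix C k l assume k: "k \<in> K" "l \<in> K"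
      have "continuous_map (weak_operator_topology K) euclidean (\<lambda>T. cinner k (T l))"
        unfolding continuous_map_def
      proof (intro conjI allI impI)
        fix U :: "complex set" assume "openin euclidean U"
        then have "open U" by (rule open_openin[THEN iffD2])
        then have "openin (weak_operator_topology K) {T \<in> bounded_operators K. cinner k (T l) \<in> U}"
          unfolding weak_operator_topology_def using k
          by (intro topology_generated_by_Basis CollectI exI[of _ k] exI[of _ l] exI[of _ U]) simp
        then show "openin (weak_operator_topology K) {T \<in> topspace (weak_operator_topology K). cinner k (T l) \<in> U}"
          unfolding topspace_weak_operator[OF ne] .
      qed simp
      from continuous_map_compose[OF cont[rule_format] this]
      show "continuous_map (?X C) euclidean (\<lambda>g. cinner k (\<pi> g l))" unfolding comp_def .
    qed
  next
    assume R: ?R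
    show "\<forall>C. continuous_map (?X C) (weak_operator_topology K) \<pi>"
    proof
      fix C
      show "continuous_map (?X C) (weak_operator_topology K) \<pi>"
        unfolding weak_operator_topology_def
      proof (rule continuous_on_generated_topo)
        fix W assume "W \<in> {{T \<in> bounded_operators K. cinner k (T l) \<in> U} | k l U. k \<in> K \<and> l \<in> K \<and> open U}"
        then obtain k l U where W: "W = {T \<in> bounded_operators K. cinner k (T l) \<in> U}"
          and k: "k \<in> K" "l \<in> K" and U: "open U" by blast
        have "openin (?X C) {g \<in> topspace (?X C). cinner k (\<pi> g l) \<in> U}"
          using R[rule_format, OF k] U[THEN open_openin[THEN iffD1]] by (rule openin_continuous_map_preimage)
        also have "{g \<in> topspace (?X C). cinner k (\<pi> g l) \<in> U} = \<pi> -` W \<inter> topspace (?X C)"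
          using X[of C] bdd unfolding W by blast
        finally show "openin (?X C) (\<pi> -` W \<inter> topspace (?X C))" .
      next
        show "\<pi> ` topspace (?X C) \<subseteq> \<Union>{{T \<in> bounded_operators K. cinner k (T l) \<in> U} | k l U. k \<in> K \<and> l \<in> K \<and> open U}"
          using X[of C] bdd topspace_weak_operator[OF ne]
          unfolding weak_operator_topology_def topology_generated_by_topspace by blast
      qed
    qed
  qed
  with star show ?thesis by (simp only: normal_representation_def simp_thms)
qed (simp add: normal_representation_def)

text \<open>Carries normality from \<open>\<pi>\<close> to \<open>\<pi>hat\<close>, which agree on
  \<open>H\<close>.\<close>

lemma normal_representation_cong:
  assumes norm: "normal_representation M \<pi> K" and ne: "K \<noteq> {}"
    and eq: "\<And>g k. g \<in> Linf M \<Longrightarrow> k \<in> K \<Longrightarrow> \<rho> g k = \<pi> g k"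
    and rep: "Linf_representation M \<rho> K"
  shows "normal_representation M \<rho> K"
  unfolding normal_representation_iff[OF ne]
proof (intro conjI allI ballI)
  have star: "star_representation M \<pi> K" using norm by (simp add: normal_representation_def)
  have "cinner k (\<rho> (\<lambda>x. cnj (g x)) l) = cinner (\<rho> g k) l" if "g \<in> Linf M" "k \<in> K" "l \<in> K" for g k l
    using star_representationD[OF star that] eq[OF Linf_cnj[OF that(1)] that(3)] eq[OF that(1,2)] by simp
  then show "star_representation M \<rho> K" using rep unfolding star_representation_def by (intro conjI ballI)
  fix C k l assume k: "k \<in> K" "l \<in> K"
  show "continuous_map (subtopology (weak_star_topology M) (Linf_ball M C)) euclidean (\<lambda>g. cinner k (\<rho> g l))"
  proof (rule continuous_map_eq)
    show "continuous_map (subtopology (weak_star_topology M) (Linf_ball M C)) euclidean (\<lambda>g. cinner k (\<pi> g l))"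
      using norm k unfolding normal_representation_iff[OF ne] by blast
    fix g assume "g \<in> topspace (subtopology (weak_star_topology M) (Linf_ball M C))"
    then have "g \<in> Linf M" using topspace_weak_star_subset[of M] unfolding topspace_subtopology by blast
    then show "cinner k (\<pi> g l) = cinner k (\<rho> g l)" using eq k by simp
  qed
qed

lemma normal_representation_subset:
  assumes norm: "normal_representation M \<pi> L" and KL: "K \<subseteq> L" and ne: "K \<noteq> {}"
    and inv: "\<And>g k. g \<in> Linf M \<Longrightarrow> k \<in> K \<Longrightarrow> \<pi> g k \<in> K"
  shows "normal_representation M \<pi> K"
proof -
  have neL: "L \<noteq> {}" using KL ne by blast
  from norm have "star_representation M \<pi> L" by (simp add: normal_representation_def)
  from star_representation_subset[OF this KL inv] have "star_representation M \<pi> K" .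
  with norm KL show ?thesis
    unfolding normal_representation_iff[OF ne] normal_representation_iff[OF neL] by blast
qed

context strongly_invariant_endomorphism
begin

text \<open>The preimage of the subbasic set for \<open>h\<close> is the one for the function
  \<open>h'\<close> that \<open>transfer\<close> provides, and composition keeps the essential bound
  \<open>C\<close>.\<close>

lemma continuous_map_weak_star_comp:
  "continuous_map (subtopology (weak_star_topology M) (Linf_ball M C))
    (subtopology (weak_star_topology M) (Linf_ball M C)) (\<lambda>g. g \<circ> r)"
proof (rule continuous_map_into_subtopology)
  let ?X = "subtopology (weak_star_topology M) (Linf_ball M C)"
  let ?S = "{{g \<in> Linf M. (LINT x|M. g x * h x) \<in> U} | h U. integrable M h \<and> open U}"
  have X: "topspace ?X = topspace (weak_star_topology M) \<inter> Linf_ball M C"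
    by (rule topspace_subtopology)
  have XL: "g \<in> Linf M" if "g \<in> topspace ?X" for g
    using that topspace_weak_star_subset[of M] unfolding X by blast
  show "(\<lambda>g. g \<circ> r) \<in> topspace ?X \<rightarrow> Linf_ball M C"
    unfolding X using Linf_ball_comp by blast
  show "continuous_map ?X (weak_star_topology M) (\<lambda>g. g \<circ> r)"
    unfolding weak_star_topology_def
  proof (rule continuous_on_generated_topo)
    fix W assume "W \<in> ?S"
    then obtain h U where W: "W = {g \<in> Linf M. (LINT x|M. g x * h x) \<in> U}" and h: "integrable M h" and U: "open U"
      by blast
    obtain h' where h': "integrable M h'"
      and eq: "\<And>g. g \<in> Linf M \<Longrightarrow> (LINT x|M. g (r x) * h x) = (LINT x|M. g x * h' x)"
      using transfer[OF h] by blast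
    have "openin (weak_star_topology M) {g \<in> Linf M. (LINT x|M. g x * h' x) \<in> U}"
      unfolding weak_star_topology_def using h' U by (intro topology_generated_by_Basis) blast
    then have "openin ?X ({g \<in> Linf M. (LINT x|M. g x * h' x) \<in> U} \<inter> Linf_ball M C)"
      by (rule openin_subtopology_Int)
    then have "openin ?X ({g \<in> Linf M. (LINT x|M. g x * h' x) \<in> U} \<inter> Linf_ball M C \<inter> topspace ?X)"
      by (rule openin_Int) (rule openin_topspace)
    also have "{g \<in> Linf M. (LINT x|M. g x * h' x) \<in> U} \<inter> Linf_ball M C \<inter> topspace ?X = (\<lambda>g. g \<circ> r) -` W \<inter> topspace ?X"
      unfolding W using Linf_comp eq XL unfolding X by (auto simp: comp_def)
    finally show "openin (subtopology (topology_generated_by ?S) (Linf_ball M C))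
      ((\<lambda>g. g \<circ> r) -` W \<inter> topspace (subtopology (topology_generated_by ?S) (Linf_ball M C)))"
      unfolding weak_star_topology_def .
  next
    have "{g \<in> Linf M. (LINT x|M. g x * 0) \<in> UNIV} \<in> ?S"
      by (intro CollectI exI[of _ "\<lambda>_. 0"] exI[of _ UNIV]) simp
    then show "(\<lambda>g. g \<circ> r) ` topspace (subtopology (topology_generated_by ?S) (Linf_ball M C))
       \<subseteq> \<Union>?S"
      using Linf_comp XL unfolding weak_star_topology_def by blast
  qed
qed

text \<open>Coefficients on \<open>K1\<close> are coefficients on \<open>K0\<close> composed with
  \<open>g \<mapsto> g \<circ> r\<close>, which is weak-* continuous on bounded sets.\<close>

lemma normal_representation_transfer:
  assumes norm: "normal_representation M \<pi> K0" and ne: "K0 \<noteq> {}" "K1 \<noteq> {}"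
    and rep: "Linf_representation M \<pi> K1"
    and U_in: "\<And>v. v \<in> K1 \<Longrightarrow> U v \<in> K0"
    and U_iso: "\<And>v w. cinner (U v) (U w) = cinner v w"
    and U_rep: "\<And>g v. g \<in> Linf M \<Longrightarrow> v \<in> K1 \<Longrightarrow> U (\<pi> g v) = \<pi> (g \<circ> r) (U v)"
  shows "normal_representation M \<pi> K1"
  unfolding normal_representation_iff[OF ne(2)]
proof (intro conjI allI ballI)
  have star: "star_representation M \<pi> K0" using norm by (simp add: normal_representation_def)
  have coeff: "cinner k (\<pi> g l) = cinner (U k) (\<pi> (g \<circ> r) (U l))" if "g \<in> Linf M" "k \<in> K1" "l \<in> K1" for g k l
    by (simp only: U_iso[symmetric, of k] U_rep[OF that(1,3)])
  have "cinner k (\<pi> (\<lambda>x. cnj (g x)) l) = cinner (\<pi> g k) l" if g: "g \<in> Linf M" and kl: "k \<in> K1" "l \<in> K1" for g k l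
  proof -
    have "cinner k (\<pi> (\<lambda>x. cnj (g x)) l) = cinner (U k) (\<pi> (\<lambda>x. cnj ((g \<circ> r) x)) (U l))"
      using coeff[OF Linf_cnj[OF g] kl] by (simp only: comp_def)
    also have "\<dots> = cinner (\<pi> (g \<circ> r) (U k)) (U l)"
      using star_representationD[OF star Linf_comp[OF g] U_in[OF kl(1)] U_in[OF kl(2)]] .
    also have "\<dots> = cinner (\<pi> g k) l"
      by (simp only: U_rep[OF g kl(1), symmetric] U_iso)
    finally show ?thesis .
  qed
  then show "star_representation M \<pi> K1" using rep unfolding star_representation_def by (intro conjI ballI)
  fix C k l assume kl: "k \<in> K1" "l \<in> K1"
  let ?X = "subtopology (weak_star_topology M) (Linf_ball M C)"
  show "continuous_map ?X euclidean (\<lambda>g. cinner k (\<pi> g l))"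
  proof (rule continuous_map_eq)
    have "continuous_map ?X euclidean (\<lambda>g. cinner (U k) (\<pi> g (U l)))"
      using norm U_in kl unfolding normal_representation_iff[OF ne(1)] by blast
    from continuous_map_compose[OF continuous_map_weak_star_comp this]
    show "continuous_map ?X euclidean (\<lambda>g. cinner (U k) (\<pi> (g \<circ> r) (U l)))" by (simp only: comp_def)
    fix g assume "g \<in> topspace ?X"
    then have "g \<in> Linf M" using topspace_weak_star_subset[of M] unfolding topspace_subtopology by blast
    then show "cinner (U k) (\<pi> (g \<circ> r) (U l)) = cinner k (\<pi> g l)" using coeff kl by simp
  qed
qed

end

section \<open>Multiplicity functions of the dilation\<close>

lemma csubspace_ominus: "csubspace V \<Longrightarrow> csubspace (V \<ominus> U)"
  unfolding complex_vector.subspace_def ominus_def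
  by (auto simp: cinner_add_right cinner_scaleC_right)

lemma closed_ominus:
  assumes "closed V" shows "closed (V \<ominus> U)"
proof -
  have "V \<ominus> U = V \<inter> (\<Inter>u\<in>U. cinner u -` {0})" by (auto simp: ominus_def)
  moreover have "closed (cinner u -` {0})" for u :: 'a
    by (intro closed_vimage closed_singleton linear_continuous_on bounded_linear_cinner_right)
  ultimately show ?thesis using assms by (simp add: closed_Int closed_INT)
qed

lemma bounded_linear_unitary:
  assumes "unitary T" shows "bounded_linear T"
proof (rule bounded_linear_intro)
  have T: "clinear_on UNIV T" and iso: "cinner (T x) (T y) = cinner x y" for x y
    using assms by (auto simp: unitary_def)
  show "T (x + y) = T x + T y" for x y using T by (simp add: clinear_on_def)
  show "T (c *\<^sub>R x) = c *\<^sub>R T x" for c x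
    unfolding scaleR_scaleC using T by (simp add: clinear_on_def)
  have "norm (T x) = norm x" for x
    using iso[of x x] unfolding cinner_self of_real_eq_iff by simp
  then show "norm (T x) \<le> norm x * 1" for x by simp
qed

lemma csubspace_vimage:
  assumes T: "clinear_on UNIV T" and K: "csubspace K" shows "csubspace (T -` K)"
proof -
  have add: "T (x + y) = T x + T y" and scale: "T (a *\<^sub>C x) = a *\<^sub>C T x" for x y a
    using T by (simp_all add: clinear_on_def)
  have "T 0 = 0" using add[of 0 0] by simp
  then show ?thesis
    using K unfolding complex_vector.subspace_def by (simp add: add scale)
qed

text \<open>Since \<open>Shat\<close> is bijective, the image of \<open>H\<close> under its inverse
  powers is written as a preimage. Multiplicity functions are determined only almost everywhere, so
  the identities are claimed for any choice of them.\<close>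

theorem theorem4p2p3:
  fixes M :: "'x measure" and r :: "'x \<Rightarrow> 'x"
    and H :: "'h::complex_hilbert set"
    and S Shat :: "'h \<Rightarrow> 'h"
    and \<pi> \<pi>hat :: "('x \<Rightarrow> complex) \<Rightarrow> 'h \<Rightarrow> 'h"
    and V :: "nat \<Rightarrow> 'h set" and W0 :: "'h set"
  assumes "prob_space M" and "countably_separated M"
    and "r \<in> measurable M M" and "\<forall>x\<in>space M. finite (fibre M r x)" and "r ` space M = space M"
    and "strongly_invariant M r"
    and "separable_space (euclidean :: 'h topology)"
    and "csubspace H" and "closed H"
    and "isometry_on H S"
    and "normal_representation M \<pi> H"
    and "\<forall>g\<in>Linf M. \<forall>k\<in>H. S (\<pi> g k) = \<pi> (g \<circ> r) (S k)"
    and "unitary Shat"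
    and "Linf_representation M \<pi>hat UNIV"
    and V_def: "V = (\<lambda>n. (Shat ^^ n) -` H)"
    and "incseq V" and "closure (\<Union>n. V n) = UNIV"
    and "\<forall>k\<in>H. Shat k = S k"
    and "\<forall>g\<in>Linf M. \<forall>k\<in>H. \<pi>hat g k = \<pi> g k"
    and "\<forall>g\<in>Linf M. \<forall>k. Shat (\<pi>hat g k) = \<pi>hat (g \<circ> r) (Shat k)"
    and W0_def: "W0 = V 1 \<ominus> V 0"
  shows "((\<forall>g\<in>Linf M. \<pi>hat g ` V 1 \<subseteq> V 1) \<and>
      normal_representation M \<pi>hat (V 1) \<and>
      (\<forall>mV0 mV1. is_multiplicity_function M \<pi>hat (V 0) mV0 \<and>
          is_multiplicity_function M \<pi>hat (V 1) mV1 \<longrightarrow>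
        (AE x in M. mV1 x = (\<Sum>y\<in>fibre M r x. mV0 y)))) \<and>
    (normal_representation M \<pi>hat W0 \<and>
      (\<forall>mV0 mW0. is_multiplicity_function M \<pi>hat (V 0) mV0 \<and>
          is_multiplicity_function M \<pi>hat W0 mW0 \<longrightarrow>
        (AE x in M. mV0 x + mW0 x = (\<Sum>y\<in>fibre M r x. mV0 y))))"
proof -
  interpret prob_space M by fact
  interpret strongly_invariant_endomorphism M r
    by unfold_locales (use assms in auto)
  obtain E c where "fibre_partition M r E c"
    using measurable_fibre_partition[OF \<open>countably_separated M\<close>]
    unfolding fibre_partition_def fibre_partition_axioms_def
    using strongly_invariant_endomorphism_axioms by metis
  then interpret P: fibre_partition M r E c .

  \<comment> \<open>Invariance and normality on \<open>V 1\<close> and \<open>W0\<close>\<close>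
  have V0: "V 0 = H" and V1: "V 1 = Shat -` H" by (simp_all add: V_def)
  have H0: "0 \<in> H" using \<open>csubspace H\<close> by (rule complex_vector.subspace_0)
  have Slin: "clinear_on UNIV Shat" and Sbij: "bij Shat"
    and Siso: "cinner (Shat v) (Shat w) = cinner v w" for v w
    using \<open>unitary Shat\<close> by (auto simp: unitary_def)
  have Srep: "Shat (\<pi>hat g k) = \<pi>hat (g \<circ> r) (Shat k)" if "g \<in> Linf M" for g k
    using assms(20) that by blast
  have hat_eq: "\<pi>hat g k = \<pi> g k" if "g \<in> Linf M" "k \<in> H" for g k
    using assms(19) that by blast
  have sub1: "csubspace (V 1)" unfolding V1 using Slin \<open>csubspace H\<close> by (rule csubspace_vimage)
  have closed1: "closed (V 1)"
    unfolding V1 using \<open>closed H\<close> bounded_linear_unitary[OF \<open>unitary Shat\<close>]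
    by (intro closed_vimage linear_continuous_on)
  have V01: "V 0 \<subseteq> V 1" using \<open>incseq V\<close> by (rule incseqD) simp
  have ne: "H \<noteq> {}" "V 1 \<noteq> {}" using H0 V01 V0 by auto
  have "star_representation M \<pi> H"
    using \<open>normal_representation M \<pi> H\<close> by (simp only: normal_representation_def)
  then have rep_H: "Linf_representation M \<pi> H"
    by (simp only: star_representation_def)
  have inv0: "\<pi>hat g k \<in> H" if "g \<in> Linf M" "k \<in> H" for g k
    using Linf_representation_in[OF rep_H that] hat_eq[OF that] by simp
  \<comment> \<open>\<open>Shat\<close> maps \<open>V 1\<close> onto \<open>H\<close> and turns
    \<open>\<pi>hat g\<close> into \<open>\<pi>hat (g \<circ> r)\<close>, so invariance is inherited
    from \<open>H\<close>.\<close>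
  have inv1: "\<pi>hat g k \<in> V 1" if "g \<in> Linf M" "k \<in> V 1" for g k
    using inv0[OF Linf_comp[OF that(1)], of "Shat k"] that(2) unfolding V1 by (simp add: Srep[OF that(1)])
  have hat_rep: "Linf_representation M \<pi>hat K" if "\<And>g k. g \<in> Linf M \<Longrightarrow> k \<in> K \<Longrightarrow> \<pi>hat g k \<in> K" for K
    using \<open>Linf_representation M \<pi>hat UNIV\<close> subset_UNIV that by (rule Linf_representation_subset)
  have normal0: "normal_representation M \<pi>hat H"
    using \<open>normal_representation M \<pi> H\<close> ne(1) hat_eq hat_rep[OF inv0] by (rule normal_representation_cong)
  \<comment> \<open>\<open>\<pi>hat\<close> is assumed to be a representation only, so the adjoint
    relation on \<open>V 1\<close> is also obtained from \<open>H\<close> through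
    \<open>Shat\<close>.\<close>
  have normal1: "normal_representation M \<pi>hat (V 1)"
  proof (rule normal_representation_transfer[OF normal0 ne hat_rep[OF inv1] _ Siso])
    show "Shat v \<in> H" if "v \<in> V 1" for v using that unfolding V1 by simp
  qed (simp_all add: Srep)
  then have star1: "star_representation M \<pi>hat (V 1)" by (simp only: normal_representation_def)
  \<comment> \<open>The orthogonal complement of an invariant subspace is invariant because the
    adjoint of \<open>\<pi>hat g\<close> on \<open>V 1\<close> is given by the conjugate of
    \<open>g\<close>.\<close>
  have invW: "\<pi>hat g k \<in> W0" if g: "g \<in> Linf M" and k: "k \<in> W0" for g k
  proof -
    have k1: "k \<in> V 1" using k by (simp add: W0_def ominus_def)
    have "cinner u (\<pi>hat g k) = 0" if u: "u \<in> V 0" for u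
    proof -
      have "cinner u (\<pi>hat g k) = cinner (\<pi>hat (\<lambda>x. cnj (g x)) u) k"
        using star_representationD[OF star1 Linf_cnj[OF g] _ k1, of u] u V01 by auto
      also have "\<dots> = 0"
        using k inv0[OF Linf_cnj[OF g], of u] u by (simp add: W0_def ominus_def V0)
      finally show ?thesis .
    qed
    with inv1[OF g k1] show ?thesis by (simp add: W0_def ominus_def)
  qed
  have W1: "W0 \<subseteq> V 1" by (auto simp: W0_def ominus_def)
  have subW: "csubspace W0" unfolding W0_def using sub1 by (rule csubspace_ominus)
  have closedW: "closed W0" unfolding W0_def using closed1 by (rule closed_ominus)
  have neW: "W0 \<noteq> {}" using complex_vector.subspace_0[OF subW] by blast
  have normalW: "normal_representation M \<pi>hat W0"
    using normal1 W1 neW invW by (rule normal_representation_subset)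

  \<comment> \<open>Coefficient densities and the transported frame\<close>
  have M0: "Linf_module M \<pi>hat H" if "is_multiplicity_function M \<pi>hat (V 0) m" for m
  proof
    show "star_representation M \<pi>hat H" using normal0 by (simp only: normal_representation_def)
    from multiplicity_function_density[OF that[unfolded V0] this]
    show "\<exists>d. integrable M d \<and> (\<forall>g\<in>Linf M. cinner k (\<pi>hat g l) = (LINT x|M. g x * d x))"
      if "k \<in> H" "l \<in> H" for k l using that .
  qed fact+
  \<comment> \<open>Moved to \<open>H\<close> by \<open>Shat\<close>, a coefficient at
    \<open>g\<close> becomes one at \<open>g \<circ> r\<close>, and \<open>transfer\<close> converts
    its density into one against \<open>g\<close>. A multiplicity function of \<open>V 0\<close>
    thus suffices, as part (ii) requires, where none of \<open>V 1\<close> is given.\<close>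
  have M1: "Linf_module M \<pi>hat (V 1)" if "is_multiplicity_function M \<pi>hat (V 0) m" for m
  proof
    interpret H: Linf_module M \<pi>hat H using that by (rule M0)
    fix k l assume k: "k \<in> V 1" and l: "l \<in> V 1"
    then have "Shat k \<in> H" "Shat l \<in> H" unfolding V1 by simp_all
    from H.ex_has_density[OF this] obtain d where d: "H.has_density (Shat k) (Shat l) d" by blast
    from transfer[OF H.has_density_integrable[OF d]] obtain d' where d': "integrable M d'"
      "\<forall>g\<in>Linf M. (LINT x|M. g (r x) * d x) = (LINT x|M. g x * d' x)" by blast
    have "cinner k (\<pi>hat g l) = (LINT x|M. g x * d' x)" if g: "g \<in> Linf M" for g
    proof -
      have "cinner k (\<pi>hat g l) = cinner (Shat k) (\<pi>hat (g \<circ> r) (Shat l))"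
        by (simp only: Siso[symmetric, of k] Srep[OF g])
      also have "\<dots> = (LINT x|M. g (r x) * d x)"
        using H.has_densityD[OF d Linf_comp[OF g]] by (simp only: comp_def)
      also have "\<dots> = (LINT x|M. g x * d' x)" using d'(2) g by blast
      finally show ?thesis .
    qed
    with d'(1) show "\<exists>d. integrable M d \<and> (\<forall>g\<in>Linf M. cinner k (\<pi>hat g l) = (LINT x|M. g x * d x))" by blast
  qed (fact star1 sub1 closed1)+
  have frame1: "\<exists>k m'. Linf_module.frame M \<pi>hat (V 1) k m' \<and>
      (\<forall>x\<in>space M. (\<Sum>i. indicator (m' i) x) = ennreal_of_enat (\<Sum>y\<in>fib x. m y))"
    if m: "is_multiplicity_function M \<pi>hat (V 0) m" for m
  proof -
    interpret H: Linf_module M \<pi>hat H using m by (rule M0)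
    from H.multiplicity_function_frame[OF m[unfolded V0]] obtain k
      where k: "H.frame k (\<lambda>n. {x\<in>space M. enat n < m x})" by blast
    have "\<exists>k'. Linf_module.frame M \<pi>hat (V 1) k'
        (\<lambda>i. case prod_decode i of (e, n) \<Rightarrow> r ` (E e \<inter> {x\<in>space M. enat n < m x}))"
    proof (rule P.frame_transfer[OF M0[OF m] M1[OF m] _ _ Siso _ k])
      show "Shat v \<in> H" if "v \<in> V 1" for v using that unfolding V1 by simp
      show "\<exists>v\<in>V 1. Shat v = w" if "w \<in> H" for w
        using bij_is_surj[OF Sbij] that unfolding V1 by (metis surj_def vimageI)
    qed (rule Srep)
    with P.transferred_count[of _ m] show ?thesis by blast
  qed

  \<comment> \<open>The two multiplicity identities\<close>
  have "AE x in M. mV1 x = (\<Sum>y\<in>fib x. mV0 y)"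
    if m0: "is_multiplicity_function M \<pi>hat (V 0) mV0" and m1: "is_multiplicity_function M \<pi>hat (V 1) mV1" for mV0 mV1
  proof -
    interpret V1: Linf_module M \<pi>hat "V 1" using m0 by (rule M1)
    from frame1[OF m0] obtain k A where k: "V1.frame k A"
      and count: "\<forall>x\<in>space M. (\<Sum>i. indicator (A i) x) = ennreal_of_enat (\<Sum>y\<in>fib x. mV0 y)" by blast
    from V1.multiplicity_function_frame[OF m1] obtain l where l: "V1.frame l (\<lambda>n. {x\<in>space M. enat n < mV1 x})" by blast
    \<comment> \<open>Both frames belong to \<open>V 1\<close>: the coordinate sections count
      \<open>mV1\<close>, the transported frame counts the fibre sum.\<close>
    from V1.frame_count_unique[OF l k] AE_space show ?thesis
    proof eventually_elim
      case (elim x)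
      have "(\<Sum>n. indicator {x\<in>space M. enat n < mV1 x} x) = ennreal_of_enat (mV1 x)"
        using suminf_indicator_less_enat[of "mV1 x"] elim(2) by (simp add: indicator_def of_bool_def)
      with elim count show ?case by simp
    qed
  qed
  moreover have "AE x in M. mV0 x + mW0 x = (\<Sum>y\<in>fib x. mV0 y)"
    if m0: "is_multiplicity_function M \<pi>hat (V 0) mV0" and mW: "is_multiplicity_function M \<pi>hat W0 mW0" for mV0 mW0
  proof -
    interpret H: Linf_module M \<pi>hat H using m0 by (rule M0)
    interpret V1: Linf_module M \<pi>hat "V 1" using m0 by (rule M1)
    have WH: "W0 = V 1 \<ominus> H" by (simp only: W0_def V0)
    interpret W: Linf_module M \<pi>hat W0
    proof
      show "star_representation M \<pi>hat W0" using normalW by (simp only: normal_representation_def)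
      show "\<exists>d. integrable M d \<and> (\<forall>g\<in>Linf M. cinner k (\<pi>hat g l) = (LINT x|M. g x * d x))"
        if "k \<in> W0" "l \<in> W0" for k l using that W1 by (intro V1.density) auto
    qed fact+
    from frame1[OF m0] obtain k A where k: "V1.frame k A"
      and count: "\<forall>x\<in>space M. (\<Sum>i. indicator (A i) x) = ennreal_of_enat (\<Sum>y\<in>fib x. mV0 y)" by blast
    from H.multiplicity_function_frame[OF m0[unfolded V0]] obtain u
      where u: "H.frame u (\<lambda>n. {x\<in>space M. enat n < mV0 x})" by blast
    from W.multiplicity_function_frame[OF mW] obtain w
      where w: "W.frame w (\<lambda>n. {x\<in>space M. enat n < mW0 x})" by blast
    \<comment> \<open>The frame of \<open>V 1\<close> to be compared with the transported one is
      assembled from the coordinate frames of \<open>H\<close> and \<open>W0\<close>, so its count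
      is \<open>mV0 x + mW0 x\<close>.\<close>
    from frame_orthogonal_sum[OF V1.Linf_module_axioms H.Linf_module_axioms W.Linf_module_axioms[unfolded WH]
        V01[unfolded V0] u w[unfolded WH]]
    obtain q where q: "V1.frame q (\<lambda>i. case prod_decode i of (s, n) \<Rightarrow>
        if s = 0 then {x\<in>space M. enat n < mV0 x} else if s = 1 then {x\<in>space M. enat n < mW0 x} else {})"
      by blast
    from V1.frame_count_unique[OF q k] AE_space show ?thesis
    proof eventually_elim
      case (elim x)
      with orthogonal_sum_count[OF elim(2), of mV0 mW0] count
      have "ennreal_of_enat (mV0 x + mW0 x) = ennreal_of_enat (\<Sum>y\<in>fib x. mV0 y)"
        by (metis (no_types, lifting))
      then show ?case by (simp only: ennreal_of_enat_inj)
    qed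
  qed
  ultimately show ?thesis
    using inv1 normal1 normalW by (intro conjI ballI allI impI image_subsetI) auto
qed

end
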